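(* Let $k \in \mathbb{N}$ be a fixed parameter. For any $\varepsilon > 0$, there exists a randomized algorithm that, given query access to a function $f \colon [n] \to \mathbb{R}$ which is $\varepsilon$-far from $(12\dots k)$-free, outputs a length-$k$ monotone subsequence of $f$ with probability at least $9/10$. The algorithm is non-adaptive and makes $(\log n)^{\lfloor \log_2 k \rfloor} \cdot \mathrm{poly}(1/\varepsilon)$ queries to $f$.
   Context: $[n]=\{1,\dots,n\}$. A length-$k$ monotone subsequence (or $(12\dots k)$-pattern) of $f\colon[n]\to\mathbb{R}$ is a tuple $(i_1,\dots,i_k)\in[n]^k$ with $i_1<\dots<i_k$ and $f(i_1)<\dots<f(i_k)$. The function $f$ is $(12\dots k)$-free if it has no such tuple, and $f$ is $\varepsilon$-far from $(12\dots k)$-free if every $(12\dots k)$-free $g\colon[n]\to\mathbb{R}$ satisfies $\Pr_{i\sim[n]}[f(i)\neq g(i)]\ge\varepsilon$ ($i$ uniform). An algorithm is non-adaptive if its set of queries does not depend on answers to previous queries. The factor $\mathrm{poly}(1/\varepsilon)$ denotes a polynomial in $1/\varepsilon$ whose degree and coefficients may depend on $k$ but not on $n$. *)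

theory Defs
  imports "HOL-Probability.Probability" "HOL-Computational_Algebra.Polynomial"
begin

text \<open>
  A function on \<open>[n]\<close> is represented by a total function of type \<open>nat \<Rightarrow> real\<close>, of which only
  the values on \<open>{1..n}\<close> are ever inspected.
\<close>

definition monotone_subsequence :: "nat \<Rightarrow> nat \<Rightarrow> (nat \<Rightarrow> real) \<Rightarrow> nat list \<Rightarrow> bool" where
  "monotone_subsequence n k f is \<longleftrightarrow>
     length is = k \<and> set is \<subseteq> {1..n} \<and> sorted_wrt (<) is \<and> sorted_wrt (<) (map f is)"

definition pattern_free :: "nat \<Rightarrow> nat \<Rightarrow> (nat \<Rightarrow> real) \<Rightarrow> bool" where
  "pattern_free n k f \<longleftrightarrow> (\<nexists>is. monotone_subsequence n k f is)"

text \<open>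
  The uniform distribution on \<open>{1..n}\<close> is meaningful only for \<open>n \<ge> 1\<close>.
\<close>

definition far_from_free :: "nat \<Rightarrow> nat \<Rightarrow> real \<Rightarrow> (nat \<Rightarrow> real) \<Rightarrow> bool" where
  "far_from_free n k \<epsilon> f \<longleftrightarrow>
     (\<forall>g. pattern_free n k g \<longrightarrow>
        measure_pmf.prob (pmf_of_set {1..n}) {i. f i \<noteq> g i} \<ge> \<epsilon>)"

text \<open>
  A deterministic query algorithm is a decision tree with real-valued answers: it stops with
  an output, or queries a position and continues depending on the answer. A randomized
  algorithm is a probability distribution over such trees (one tree for each outcome of the
  internal coins).
\<close>

datatype 'o query_tree = Output 'o | Query nat "real \<Rightarrow> 'o query_tree"

type_synonym 'o randomized_algorithm = "'o query_tree pmf"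

primrec run :: "'o query_tree \<Rightarrow> (nat \<Rightarrow> real) \<Rightarrow> 'o" where
  "run (Output x) f = x"
| "run (Query i c) f = run (c (f i)) f"

text \<open>
  The list of queries made on input \<open>f\<close>, in order and with repetitions.
\<close>

primrec queries :: "'o query_tree \<Rightarrow> (nat \<Rightarrow> real) \<Rightarrow> nat list" where
  "queries (Output x) f = []"
| "queries (Query i c) f = i # queries (c (f i)) f"

text \<open>
  Once the internal coins are fixed, the set of queries is the same for every input.
\<close>

definition nonadaptive :: "'o randomized_algorithm \<Rightarrow> bool" where
  "nonadaptive A \<longleftrightarrow> (\<forall>t\<in>set_pmf A. \<forall>f g. set (queries t f) = set (queries t g))"

definition queries_inside :: "nat \<Rightarrow> 'o randomized_algorithm \<Rightarrow> bool" where
  "queries_inside n A \<longleftrightarrow> (\<forall>t\<in>set_pmf A. \<forall>f. set (queries t f) \<subseteq> {1..n})"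

definition makes_at_most_queries :: "'o randomized_algorithm \<Rightarrow> real \<Rightarrow> bool" where
  "makes_at_most_queries A q \<longleftrightarrow> (\<forall>t\<in>set_pmf A. \<forall>f. real (length (queries t f)) \<le> q)"

end

theory Submission
  imports Defs "HOL-Library.Discrete_Functions"
begin

text \<open>
  The search for length \<open>k\<close> starts at a random point \<open>x\<close>: it searches from \<open>x\<close> for length \<open>k - 1\<close>
  and, in the window of every dyadic radius around \<open>x\<close>, from a random point for length
  \<open>k div 2\<close>. This costs \<open>N\<^sub>k = N\<^bsub>k-1\<^esub> + O(log n) N\<^bsub>k div 2\<^esub>\<close> queries, hence the exponent
  \<open>\<lfloor>log\<^sub>2 k\<rfloor>\<close>.

  For the analysis, pick disjoint ascending \<open>k\<close>-tuples greedily in lexicographic order and keep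
  those whose largest gap follows the \<open>c\<close>-th entry. A second moment bound yields linearly many
  points \<open>l\<close> that lie well inside gaps of total weight \<open>\<Omega>(\<epsilon>)\<close>, a tuple of gap \<open>g\<close> having weight
  \<open>1 / g\<close>. If at such a point no single scale dominates, greediness makes the values on the right
  ends of the gaps grow with the scale, and independent samples at all scales find an ascending
  tuple. Otherwise one scale contains a dense set of tuples around \<open>l\<close>; cutting it at a median
  separates the tuples into compatible \<open>c\<close>-prefixes and \<open>(k - c)\<close>-suffixes. By induction many
  starting points find the longer piece, and from these the shorter one is found by the search for
  length \<open>k div 2\<close> at the right scale.
\<close>

section \<open>Ascending tuples and greedy families\<close>

text \<open>The obstacle is the exponent. Guessing the scale for both pieces of a cut tuple could
  cost a factor log n per unit of length; only the shorter piece, of length at most k div 2, may be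
  paid for in this way. The longer piece must be found from the very point x at which the search
  already stands, so the induction cannot merely assert that a random start succeeds: it asserts
  that a fraction of all points of an interval, depending only on k and \<epsilon>, are good
  starting points (\<open>findable\<close>). Hence linearly many points l are needed instead of one:
  the second moment bound excludes that the weight piles up on few points, and a covering argument
  turns many points l into many starting points near them. Distance from pattern-freeness is
  replaced by the size of hitting sets, which makes sense on any subset of an interval and for
  prefixes and suffixes of disjoint tuples. The search knows neither f nor the interval, the cut or
  the scale; these occur only in the analysis.\<close>

abbreviation ascending :: "(nat \<Rightarrow> real) \<Rightarrow> nat list \<Rightarrow> bool" where
  "ascending f xs \<equiv> sorted_wrt (\<lambda>x y. x < y \<and> f x < f y) xs"

definition contains_ascending :: "(nat \<Rightarrow> real) \<Rightarrow> nat \<Rightarrow> nat set \<Rightarrow> bool" where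
  "contains_ascending f k S \<longleftrightarrow> (\<exists>xs. length xs = k \<and> set xs \<subseteq> S \<and> ascending f xs)"

text \<open>A lower bound on the transversal number of the ascending k-tuples in S. It replaces
  distance from pattern-freeness on arbitrary point sets, where no function has to be
  altered.\<close>

definition hitting_at_least :: "(nat \<Rightarrow> real) \<Rightarrow> nat \<Rightarrow> nat set \<Rightarrow> real \<Rightarrow> bool" where
  "hitting_at_least f k S h \<longleftrightarrow>
     (\<forall>Z. finite Z \<longrightarrow> real (card Z) < h \<longrightarrow> contains_ascending f k (S - Z))"

lemma contains_ascending_mono:
  "contains_ascending f k S \<Longrightarrow> S \<subseteq> S' \<Longrightarrow> contains_ascending f k S'"
  unfolding contains_ascending_def by blast

lemma monotone_subsequence_iff:
  "monotone_subsequence n k f xs \<longleftrightarrow> length xs = k \<and> set xs \<subseteq> {1..n} \<and> ascending f xs"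
proof -
  have "ascending f xs \<longleftrightarrow> sorted_wrt (<) xs \<and> sorted_wrt (<) (map f xs)"
    by (induction xs) auto
  then show ?thesis
    unfolding monotone_subsequence_def by auto
qed

text \<open>Each tuple of a disjoint family needs its own point of a hitting set, so choosing such
  points injects Y into Z.\<close>

lemma hitting_at_least_disjoint_family:
  fixes P :: "'a \<Rightarrow> nat list"
  assumes "finite Y"
    and P: "\<And>y. y \<in> Y \<Longrightarrow> length (P y) = m \<and> set (P y) \<subseteq> S \<and> ascending f (P y)"
    and disj: "\<And>y z. y \<in> Y \<Longrightarrow> z \<in> Y \<Longrightarrow> y \<noteq> z \<Longrightarrow> set (P y) \<inter> set (P z) = {}"
    and h: "h \<le> real (card Y)"
  shows "hitting_at_least f m S h"
  unfolding hitting_at_least_def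
proof (intro allI impI, rule ccontr)
  fix Z assume Z: "finite Z" "real (card Z) < h" "\<not> contains_ascending f m (S - Z)"
  have "\<exists>z. z \<in> set (P y) \<inter> Z" if "y \<in> Y" for y
    using P[OF that] Z(3) unfolding contains_ascending_def by blast
  then obtain z where z: "\<And>y. y \<in> Y \<Longrightarrow> z y \<in> set (P y) \<inter> Z"
    by metis
  have "inj_on z Y"
    using z disj by (intro inj_onI) (metis IntD1 disjoint_iff)
  then have "card Y \<le> card Z"
    using z Z(1) by (intro card_inj_on_le[of z]) auto
  then show False
    using h Z(2) by simp
qed

text \<open>Exchange argument: each step removes the points of the lexicographically least tuple
  \<tau>. If a later \<sigma> had its entry at index c inside the gap of \<tau> and above \<tau> !
  (c - 1) in value, the first c entries of \<tau> followed by the rest of \<sigma> would form a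
  smaller tuple. The order of selection is expressed through heads, which increase with it, so that
  the property passes to subfamilies.\<close>

lemma greedy_family:
  assumes "finite S" "0 < k"
  shows "\<exists>X. finite X \<and> (\<forall>\<tau>\<in>X. length \<tau> = k \<and> set \<tau> \<subseteq> S \<and> ascending f \<tau>)
    \<and> (\<forall>\<tau>\<in>X. \<forall>\<sigma>\<in>X. \<tau> \<noteq> \<sigma> \<longrightarrow> set \<tau> \<inter> set \<sigma> = {})
    \<and> (\<forall>\<tau>\<in>X. \<forall>\<sigma>\<in>X. \<forall>c. hd \<tau> < hd \<sigma> \<longrightarrow> 0 < c \<longrightarrow> c < k \<longrightarrow>
          \<tau> ! (c - 1) < \<sigma> ! c \<longrightarrow> \<sigma> ! c < \<tau> ! c \<longrightarrow> f (\<sigma> ! c) \<le> f (\<tau> ! (c - 1)))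
    \<and> \<not> contains_ascending f k (S - \<Union>(set ` X))"
  using assms(1)
proof (induction S rule: finite_psubset_induct)
  case (psubset S)
  show ?case
  proof (cases "contains_ascending f k S")
    case False
    then show ?thesis by (intro exI[of _ "{}"]) auto
  next
    case True
    let ?A = "{xs. length xs = k \<and> set xs \<subseteq> S \<and> ascending f xs}"
    obtain \<tau> where \<tau>: "\<tau> \<in> ?A" and min: "\<And>\<sigma>. (\<sigma>, \<tau>) \<in> lex less_than \<Longrightarrow> \<sigma> \<notin> ?A"
    proof -
      obtain xs where "xs \<in> ?A" using True unfolding contains_ascending_def by blast
      from wfE_min[OF wf_lex[OF wf_less_than] this] that show thesis .
    qed
    have ne: "\<tau> \<noteq> []" using \<tau> assms(2) by auto
    have "S - set \<tau> \<subset> S"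
      using \<tau> ne by (cases \<tau>) auto
    from psubset.IH[OF this] obtain X where X: "finite X"
        "\<forall>\<sigma>\<in>X. length \<sigma> = k \<and> set \<sigma> \<subseteq> S - set \<tau> \<and> ascending f \<sigma>"
        "\<forall>\<sigma>\<in>X. \<forall>\<rho>\<in>X. \<sigma> \<noteq> \<rho> \<longrightarrow> set \<sigma> \<inter> set \<rho> = {}"
      and g: "\<forall>\<sigma>\<in>X. \<forall>\<rho>\<in>X. \<forall>c. hd \<sigma> < hd \<rho> \<longrightarrow> 0 < c \<longrightarrow> c < k \<longrightarrow>
          \<sigma> ! (c - 1) < \<rho> ! c \<longrightarrow> \<rho> ! c < \<sigma> ! c \<longrightarrow> f (\<rho> ! c) \<le> f (\<sigma> ! (c - 1))"
      and maxi: "\<not> contains_ascending f k (S - set \<tau> - \<Union>(set ` X))"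
      by (elim exE conjE) (rule that)
    note X2 = bspec[OF X(2)]
    \<comment> \<open>Minimality of \<tau> leaves equal heads possible; they are excluded because
      \<sigma> avoids the points of \<tau>.\<close>
    have hd_less: "hd \<tau> < hd \<sigma>" if "\<sigma> \<in> X" for \<sigma>
    proof (rule ccontr)
      assume "\<not> hd \<tau> < hd \<sigma>"
      moreover have "\<sigma> \<noteq> []" using X2[OF that] assms(2) by auto
      moreover have "hd \<sigma> \<noteq> hd \<tau>"
        using X2[OF that] ne \<open>\<sigma> \<noteq> []\<close> by (metis DiffD2 hd_in_set subsetD)
      ultimately have "(\<sigma>, \<tau>) \<in> lex less_than"
        using X2[OF that] \<tau> ne by (auto simp: neq_Nil_conv)
      from min[OF this] show False
        using X2[OF that] by auto
    qed
    have new: "f (\<sigma> ! c) \<le> f (\<tau> ! (c - 1))"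
      if s: "\<sigma> \<in> X" and c: "0 < c" "c < k" and less: "\<tau> ! (c - 1) < \<sigma> ! c" "\<sigma> ! c < \<tau> ! c" for \<sigma> c
    proof (rule ccontr)
      assume "\<not> f (\<sigma> ! c) \<le> f (\<tau> ! (c - 1))"
      then have flt: "f (\<tau> ! (c - 1)) < f (\<sigma> ! c)" by simp
      have len: "length \<tau> = k" "length \<sigma> = k" using \<tau> X2[OF s] by auto
      let ?\<rho> = "take c \<tau> @ drop c \<sigma>"
      have inc\<tau>: "x \<le> \<tau> ! (c - 1) \<and> f x \<le> f (\<tau> ! (c - 1))" if x: "x \<in> set (take c \<tau>)" for x
      proof -
        obtain i where i: "i < c" "x = \<tau> ! i"
          using x len c by (auto simp: in_set_conv_nth)
        have "i = c - 1 \<or> i < c - 1" using i by auto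
        then show ?thesis
          using i \<tau> c len sorted_wrt_nth_less[of "\<lambda>x y. x < y \<and> f x < f y" \<tau> i "c - 1"]
          by (auto intro: less_imp_le)
      qed
      have inc\<sigma>: "\<sigma> ! c \<le> x \<and> f (\<sigma> ! c) \<le> f x" if x: "x \<in> set (drop c \<sigma>)" for x
      proof -
        obtain i where i: "c + i < k" "x = \<sigma> ! (c + i)"
          using x len c
          by (metis add.commute in_set_conv_nth length_drop less_diff_conv nth_drop order_less_imp_le)
        have "i = 0 \<or> 0 < i" by auto
        then show ?thesis
          using i X2[OF s] c sorted_wrt_nth_less[of "\<lambda>x y. x < y \<and> f x < f y" \<sigma> c "c + i"] by auto
      qed
      have cross: "x < y \<and> f x < f y" if "x \<in> set (take c \<tau>)" "y \<in> set (drop c \<sigma>)" for x y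
        using inc\<tau>[OF that(1)] inc\<sigma>[OF that(2)] less(1) flt by linarith
      have "ascending f ?\<rho>"
        unfolding sorted_wrt_append
        using \<tau> X2[OF s] cross
        by (auto intro!: sorted_wrt_take sorted_wrt_drop)
      moreover have "set ?\<rho> \<subseteq> S"
        using \<tau> X2[OF s] set_take_subset[of c \<tau>] set_drop_subset[of c \<sigma>] by auto
      moreover have "length ?\<rho> = k" using len c by simp
      ultimately have "?\<rho> \<in> ?A" by simp
      moreover have "(?\<rho>, \<tau>) \<in> lex less_than"
      proof -
        have "?\<rho> = take c \<tau> @ \<sigma> ! c # drop (Suc c) \<sigma>" "\<tau> = take c \<tau> @ \<tau> ! c # drop (Suc c) \<tau>"
          using len c by (simp_all add: Cons_nth_drop_Suc)
        moreover have "(take c \<tau> @ \<sigma> ! c # drop (Suc c) \<sigma>, take c \<tau> @ \<tau> ! c # drop (Suc c) \<tau>) \<in> lex less_than"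
          by (rule lex_append_leftI) (use less(2) len in simp)
        ultimately show ?thesis by simp
      qed
      ultimately show False using min by blast
    qed
    have apart: "set \<sigma> \<inter> set \<tau> = {}" if "\<sigma> \<in> X" for \<sigma>
      using X2[OF that] by blast
    show ?thesis
    proof (intro exI[of _ "insert \<tau> X"] conjI ballI impI allI)
      fix \<sigma> \<rho> c
      assume h: "\<sigma> \<in> insert \<tau> X" "\<rho> \<in> insert \<tau> X" "hd \<sigma> < hd \<rho>" "0 < c" "c < k"
          "\<sigma> ! (c - 1) < \<rho> ! c" "\<rho> ! c < \<sigma> ! c"
      then have "\<rho> \<in> X" using hd_less by fastforce
      show "f (\<rho> ! c) \<le> f (\<sigma> ! (c - 1))"
      proof (cases "\<sigma> = \<tau>")
        case True
        then show ?thesis using new[OF \<open>\<rho> \<in> X\<close> h(4,5)] h(6,7) by simp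
      next
        case False
        then show ?thesis using g h \<open>\<rho> \<in> X\<close> by simp
      qed
    next
      have "S - \<Union> (set ` insert \<tau> X) = S - set \<tau> - \<Union> (set ` X)" by auto
      then show "\<not> contains_ascending f k (S - \<Union> (set ` insert \<tau> X))"
        using maxi by simp
    next
      show "finite (insert \<tau> X)" using X(1) by simp
    next
      fix \<sigma> assume "\<sigma> \<in> insert \<tau> X"
      then show "length \<sigma> = k" "set \<sigma> \<subseteq> S" "ascending f \<sigma>"
        using X2[of \<sigma>] \<tau> by auto
    next
      fix \<sigma> \<rho> assume "\<sigma> \<in> insert \<tau> X" "\<rho> \<in> insert \<tau> X" "\<sigma> \<noteq> \<rho>"
      then show "set \<sigma> \<inter> set \<rho> = {}"
        using X(3) apart by (metis Int_commute insertE)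
    qed
  qed
qed

text \<open>The median is the least value of v with at least half of X at or below it. Smaller
  values fail this, which leaves at least half of X at or above m.\<close>

lemma exists_median:
  fixes v :: "'a \<Rightarrow> 'b :: linorder"
  assumes "finite X" "X \<noteq> {}"
  obtains m where "card X \<le> 2 * card {x\<in>X. v x \<le> m}" "card X \<le> 2 * card {x\<in>X. m \<le> v x}"
proof -
  let ?M = "{y\<in>v ` X. card X \<le> 2 * card {x\<in>X. v x \<le> y}}"
  have "{x\<in>X. v x \<le> Max (v ` X)} = X"
    using assms by auto
  then have "Max (v ` X) \<in> ?M"
    using assms by (auto intro: Max_in)
  then have ne: "?M \<noteq> {}" "finite ?M" using assms(1) by auto
  define m where "m = Min ?M"
  have m: "m \<in> ?M" unfolding m_def using ne by (metis (no_types, lifting) Min_in)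
  have "card X \<le> 2 * card {x\<in>X. m \<le> v x}"
  proof (cases "{x\<in>X. v x < m} = {}")
    case True
    then have "{x\<in>X. m \<le> v x} = X" by force
    then show ?thesis by simp
  next
    case False
    define y where "y = Max (v ` {x\<in>X. v x < m})"
    have y: "y \<in> v ` {x\<in>X. v x < m}"
      unfolding y_def using False assms(1) by (intro Max_in) auto
    then have "y \<notin> ?M" using Min_le[OF ne(2), of y] unfolding m_def[symmetric] by fastforce
    then have "2 * card {x\<in>X. v x \<le> y} < card X" using y by auto
    moreover have "v x \<le> y" if "x \<in> X" "v x < m" for x
      unfolding y_def using that assms(1) by (intro Max_ge) auto
    then have "{x\<in>X. v x \<le> y} \<supseteq> {x\<in>X. v x < m}" by auto
    then have "card {x\<in>X. v x < m} \<le> card {x\<in>X. v x \<le> y}"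
      using assms(1) by (intro card_mono) auto
    moreover have "card X = card ({x\<in>X. v x < m} \<union> {x\<in>X. m \<le> v x})"
      by (rule arg_cong[of _ _ card]) auto
    ultimately show ?thesis
      using card_Un_le[of "{x\<in>X. v x < m}" "{x\<in>X. m \<le> v x}"] by linarith
  qed
  then show thesis using m that by blast
qed

text \<open>A Vitali covering argument. The interval of largest radius is kept and the points of G
  within twice its radius are dropped; the intervals of the remaining points miss it. The constant 5
  comes from 4 \<rho> + 1 \<le> 5 \<rho> for radii at least 1.\<close>

lemma interval_covering:
  fixes \<rho> :: "nat \<Rightarrow> nat"
  assumes "finite G" "finite H" "0 \<le> \<beta>"
    and "\<And>l. l \<in> G \<Longrightarrow> 1 \<le> \<rho> l"
    and "\<And>l. l \<in> G \<Longrightarrow> \<beta> * real (\<rho> l) \<le> real (card (H \<inter> {l - \<rho> l..l + \<rho> l}))"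
  shows "\<beta> * real (card G) \<le> 5 * real (card H)"
  using assms
proof (induction G arbitrary: H rule: finite_psubset_induct)
  case (psubset G)
  show ?case
  proof (cases "G = {}")
    case True
    then show ?thesis by simp
  next
    case False
    have "Max (\<rho> ` G) \<in> \<rho> ` G" using False psubset.hyps by (intro Max_in) auto
    then obtain l where l: "l \<in> G" "\<rho> l = Max (\<rho> ` G)" by auto
    then have max: "\<And>y. y \<in> G \<Longrightarrow> \<rho> y \<le> \<rho> l"
      using psubset.hyps by simp
    define I where "I = {l - \<rho> l..l + \<rho> l}"
    define G' where "G' = G - {l - 2 * \<rho> l..l + 2 * \<rho> l}"
    have "l \<notin> G'" unfolding G'_def by simp
    then have sub: "G' \<subset> G" using l(1) unfolding G'_def by blast
    have "\<beta> * real (card G') \<le> 5 * real (card (H - I))"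
    proof (rule psubset.IH[OF sub])
      fix y assume y: "y \<in> G'"
      then have "y \<in> G" and far: "y + 2 * \<rho> l < l \<or> l + 2 * \<rho> l < y"
        unfolding G'_def by auto
      have False if "y - \<rho> y \<le> z" "z \<le> y + \<rho> y" "l - \<rho> l \<le> z" "z \<le> l + \<rho> l" for z
        using that far max[OF \<open>y \<in> G\<close>] unfolding le_diff_conv by linarith
      then have "{y - \<rho> y..y + \<rho> y} \<inter> I = {}"
        unfolding I_def by (metis IntE atLeastAtMost_iff equals0I)
      then have "(H - I) \<inter> {y - \<rho> y..y + \<rho> y} = H \<inter> {y - \<rho> y..y + \<rho> y}" by auto
      then show "\<beta> * real (\<rho> y) \<le> real (card ((H - I) \<inter> {y - \<rho> y..y + \<rho> y}))"
        using psubset.prems(4)[OF \<open>y \<in> G\<close>] by simp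
    qed (use psubset.prems sub in auto)
    moreover have "real (card G) \<le> real (card G') + 5 * real (\<rho> l)"
    proof -
      have "card G \<le> card (G' \<union> {l - 2 * \<rho> l..l + 2 * \<rho> l})"
        unfolding G'_def using psubset.hyps by (intro card_mono) auto
      also have "\<dots> \<le> card G' + card {l - 2 * \<rho> l..l + 2 * \<rho> l}" by (rule card_Un_le)
      also have "card {l - 2 * \<rho> l..l + 2 * \<rho> l} \<le> 5 * \<rho> l"
        using psubset.prems(3)[OF l(1)] unfolding card_atLeastAtMost by linarith
      finally show ?thesis by linarith
    qed
    then have "\<beta> * real (card G) \<le> \<beta> * real (card G') + 5 * (\<beta> * real (\<rho> l))"
      using mult_left_mono[OF _ \<open>0 \<le> \<beta>\<close>] by (fastforce simp: algebra_simps)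
    moreover have "\<beta> * real (\<rho> l) \<le> real (card (H \<inter> I))"
      using psubset.prems(4)[OF l(1)] unfolding I_def .
    moreover have "real (card H) = real (card (H - I)) + real (card (H \<inter> I))"
      using card_Diff_subset_Int[of H I] psubset.prems(1) card_mono[of H "H \<inter> I"]
      by (simp add: of_nat_diff)
    ultimately show ?thesis by argo
  qed
qed

section \<open>Gaps of a greedy family\<close>

text \<open>The cut c is common to all tuples: their largest gap lies between the indices c - 1 and
  c. The exchange inequality is kept at this cut only.\<close>

locale gap_family =
  fixes f :: "nat \<Rightarrow> real" and k c a b :: nat and X :: "nat list set"
  assumes finite_X: "finite X"
    and c: "0 < c" "c < k"
    and tuple: "\<tau> \<in> X \<Longrightarrow> length \<tau> = k \<and> set \<tau> \<subseteq> {a..b} \<and> ascending f \<tau>"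
    and disjoint: "\<tau> \<in> X \<Longrightarrow> \<sigma> \<in> X \<Longrightarrow> \<tau> \<noteq> \<sigma> \<Longrightarrow> set \<tau> \<inter> set \<sigma> = {}"
    and greedy: "\<tau> \<in> X \<Longrightarrow> \<sigma> \<in> X \<Longrightarrow> hd \<tau> < hd \<sigma> \<Longrightarrow>
      \<tau> ! (c - 1) < \<sigma> ! c \<Longrightarrow> \<sigma> ! c < \<tau> ! c \<Longrightarrow> f (\<sigma> ! c) \<le> f (\<tau> ! (c - 1))"
    and max_gap: "\<tau> \<in> X \<Longrightarrow> Suc i < k \<Longrightarrow> \<tau> ! Suc i - \<tau> ! i \<le> \<tau> ! c - \<tau> ! (c - 1)"
begin

definition left :: "nat list \<Rightarrow> nat" where "left \<tau> = \<tau> ! (c - 1)"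
definition right :: "nat list \<Rightarrow> nat" where "right \<tau> = \<tau> ! c"
definition gap :: "nat list \<Rightarrow> nat" where "gap \<tau> = right \<tau> - left \<tau>"
text \<open>A quarter of the gap on either side leaves room for whole tuples of much smaller gap,
  while at least half of the gap is retained.\<close>

definition mid :: "nat list \<Rightarrow> nat set" where
  "mid \<tau> = {left \<tau> + gap \<tau> div 4..<right \<tau> - gap \<tau> div 4}"
text \<open>Dividing by the gap makes every tuple contribute between 1/2 and 1 in total, whatever
  its scale.\<close>

definition weight :: "nat \<Rightarrow> real" where
  "weight l = (\<Sum>\<tau>\<in>X. indicator (mid \<tau>) l / real (gap \<tau>))"

lemma nth_less:
  assumes "\<tau> \<in> X" "i < j" "j < k"
  shows "\<tau> ! i < \<tau> ! j \<and> f (\<tau> ! i) < f (\<tau> ! j)"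
  using tuple[OF assms(1)] assms(2,3)
    sorted_wrt_nth_less[of "\<lambda>x y. x < y \<and> f x < f y" \<tau> i j] by simp

lemma left_less_right: "\<tau> \<in> X \<Longrightarrow> left \<tau> < right \<tau> \<and> f (left \<tau>) < f (right \<tau>)"
  unfolding left_def right_def using nth_less[of \<tau> "c - 1" c] c by simp

lemma right_eq: "\<tau> \<in> X \<Longrightarrow> right \<tau> = left \<tau> + gap \<tau>"
  unfolding gap_def using left_less_right by fastforce

lemma gap_pos: "\<tau> \<in> X \<Longrightarrow> 0 < gap \<tau>"
  unfolding gap_def using left_less_right by simp

text \<open>The cut is at the largest gap, so this gap controls the spread of the whole
  tuple.\<close>

lemma nth_diff_le:
  assumes "\<tau> \<in> X" "i + d < k"
  shows "\<tau> ! (i + d) \<le> \<tau> ! i + d * gap \<tau>"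
  using assms(2)
proof (induction d)
  case (Suc d)
  have "\<tau> ! Suc (i + d) - \<tau> ! (i + d) \<le> gap \<tau>"
    using max_gap[OF assms(1)] Suc.prems unfolding gap_def left_def right_def by simp
  then show ?case using Suc by simp
qed simp

lemma left_mem: "\<tau> \<in> X \<Longrightarrow> left \<tau> \<in> set (take c \<tau>)"
  unfolding left_def using c tuple[of \<tau>]
  by (auto simp: in_set_conv_nth intro!: exI[of _ "c - 1"])

lemma right_mem: "\<tau> \<in> X \<Longrightarrow> right \<tau> \<in> set (drop c \<tau>)"
  unfolding right_def using c tuple[of \<tau>]
  by (auto simp: in_set_conv_nth intro!: exI[of _ 0])

lemma prefix_bounds:
  assumes "\<tau> \<in> X" "x \<in> set (take c \<tau>)"
  shows "x \<le> left \<tau>" "f x \<le> f (left \<tau>)" "left \<tau> \<le> x + k * gap \<tau>"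
proof -
  obtain i where i: "i < c" "x = \<tau> ! i"
    using assms tuple c by (auto simp: in_set_conv_nth)
  have "i = c - 1 \<or> i < c - 1" using i(1) by auto
  then show "x \<le> left \<tau>" "f x \<le> f (left \<tau>)"
    using nth_less[OF assms(1), of i "c - 1"] c i unfolding left_def by (auto intro: less_imp_le)
  have "left \<tau> \<le> x + (c - 1 - i) * gap \<tau>"
    using nth_diff_le[OF assms(1), of i "c - 1 - i"] i c unfolding left_def by simp
  also have "(c - 1 - i) * gap \<tau> \<le> k * gap \<tau>"
    using c by (intro mult_right_mono) auto
  finally show "left \<tau> \<le> x + k * gap \<tau>" by simp
qed

lemma suffix_bounds:
  assumes "\<tau> \<in> X" "x \<in> set (drop c \<tau>)"
  shows "right \<tau> \<le> x" "f (right \<tau>) \<le> f x" "x \<le> right \<tau> + k * gap \<tau>"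
proof -
  obtain i where i: "c + i < k" "x = \<tau> ! (c + i)"
    using assms tuple[OF assms(1)] c
    by (metis add.commute in_set_conv_nth length_drop less_diff_conv nth_drop order_less_imp_le)
  have "i = 0 \<or> 0 < i" by auto
  then show "right \<tau> \<le> x" "f (right \<tau>) \<le> f x"
    using nth_less[OF assms(1), of c "c + i"] c i unfolding right_def by auto
  have "x \<le> right \<tau> + i * gap \<tau>"
    using nth_diff_le[OF assms(1) i(1)] i unfolding right_def by simp
  also have "i * gap \<tau> \<le> k * gap \<tau>"
    using i by (intro mult_right_mono) auto
  finally show "x \<le> right \<tau> + k * gap \<tau>" by simp
qed

lemma hd_mem: "\<tau> \<in> X \<Longrightarrow> hd \<tau> \<in> set (take c \<tau>)"
  using tuple[of \<tau>] c by (cases \<tau>; cases c) auto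

lemma left_range: "\<tau> \<in> X \<Longrightarrow> left \<tau> \<in> {a..b}"
  using left_mem tuple in_set_takeD by fast

lemma right_range: "\<tau> \<in> X \<Longrightarrow> right \<tau> \<in> {a..b}"
  using right_mem tuple in_set_dropD by fast

lemma inj_left: "inj_on left X"
proof (rule inj_onI, rule ccontr)
  fix \<tau> \<sigma> assume h: "\<tau> \<in> X" "\<sigma> \<in> X" "left \<tau> = left \<sigma>" "\<tau> \<noteq> \<sigma>"
  have "left \<tau> \<in> set \<tau>" "left \<sigma> \<in> set \<sigma>"
    using left_mem[OF h(1)] left_mem[OF h(2)] by (auto dest: in_set_takeD)
  then show False using disjoint[OF h(1,2,4)] h(3) by auto
qed

lemma inj_right: "inj_on right X"
proof (rule inj_onI, rule ccontr)
  fix \<tau> \<sigma> assume h: "\<tau> \<in> X" "\<sigma> \<in> X" "right \<tau> = right \<sigma>" "\<tau> \<noteq> \<sigma>"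
  have "right \<tau> \<in> set \<tau>" "right \<sigma> \<in> set \<sigma>"
    using right_mem[OF h(1)] right_mem[OF h(2)] by (auto dest: in_set_dropD)
  then show False using disjoint[OF h(1,2,4)] h(3) by auto
qed

lemma mid_bounds:
  assumes "\<tau> \<in> X" "l \<in> mid \<tau>"
  shows "left \<tau> + gap \<tau> div 4 \<le> l" "l + gap \<tau> div 4 < right \<tau>"
  using assms unfolding mid_def by auto

lemma mid_subset: "\<tau> \<in> X \<Longrightarrow> mid \<tau> \<subseteq> {a..b}"
  using left_range right_range unfolding mid_def by fastforce

lemma card_mid: "\<tau> \<in> X \<Longrightarrow> gap \<tau> \<le> 2 * card (mid \<tau>) \<and> card (mid \<tau>) \<le> gap \<tau>"
  unfolding mid_def using right_eq by auto

text \<open>The left end of \<tau> is at least 2 (k + 2) gaps of \<sigma> to the left of l, whereas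
  all of \<sigma> stays within k + 1 of its gaps from l. So \<tau> has the smaller head and
  \<open>right \<sigma>\<close> falls into the gap of \<tau>; the exchange inequality puts its value
  at or below f (left \<tau>), which is below f (right \<tau>).\<close>

lemma nested:
  assumes "\<tau> \<in> X" "\<sigma> \<in> X" "l \<in> mid \<tau>" "l \<in> mid \<sigma>" "8 * (k + 2) * gap \<sigma> \<le> gap \<tau>"
  shows "right \<sigma> < right \<tau> \<and> f (right \<sigma>) < f (right \<tau>)"
proof -
  have g: "2 * (k + 2) * gap \<sigma> \<le> gap \<tau> div 4"
    using div_le_mono[OF assms(5), of 4] by (simp add: algebra_simps)
  then have g': "2 * (k * gap \<sigma>) + 4 * gap \<sigma> \<le> gap \<tau> div 4" by (simp add: algebra_simps)
  note m = mid_bounds[OF assms(1,3)] mid_bounds[OF assms(2,4)]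
  note e = right_eq[OF assms(1)] right_eq[OF assms(2)] gap_pos[OF assms(2)]
  have "hd \<tau> \<le> left \<tau>" using prefix_bounds(1)[OF assms(1) hd_mem[OF assms(1)]] .
  moreover have "left \<sigma> \<le> hd \<sigma> + k * gap \<sigma>" using prefix_bounds(3)[OF assms(2) hd_mem[OF assms(2)]] .
  ultimately have "hd \<tau> < hd \<sigma>" using m e g' by linarith
  moreover have "left \<tau> < right \<sigma>" "right \<sigma> < right \<tau>" using m e g' by linarith+
  ultimately have "f (right \<sigma>) \<le> f (left \<tau>)"
    using greedy[OF assms(1,2)] unfolding left_def right_def by simp
  then show ?thesis
    using \<open>right \<sigma> < right \<tau>\<close> left_less_right[OF assms(1)] by simp
qed

section \<open>First and second moment of the weights\<close>

lemma sum_weight: "real (card X) / 2 \<le> (\<Sum>l\<in>{a..b}. weight l)"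
proof -
  have "(\<Sum>l\<in>{a..b}. weight l) = (\<Sum>\<tau>\<in>X. \<Sum>l\<in>{a..b}. indicator (mid \<tau>) l / real (gap \<tau>))"
    unfolding weight_def by (rule sum.swap)
  also have "\<dots> = (\<Sum>\<tau>\<in>X. real (card (mid \<tau>)) / real (gap \<tau>))"
  proof (rule sum.cong)
    fix \<tau> assume "\<tau> \<in> X"
    have "(\<Sum>l\<in>{a..b}. indicator (mid \<tau>) l :: real) = real (card (mid \<tau>))"
      using mid_subset[OF \<open>\<tau> \<in> X\<close>] by (simp add: indicator_def sum_of_bool_eq Int_absorb1)
    then show "(\<Sum>l\<in>{a..b}. indicator (mid \<tau>) l / real (gap \<tau>)) = real (card (mid \<tau>)) / real (gap \<tau>)"
      by (simp add: sum_divide_distrib[symmetric])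
  qed simp
  also have "\<dots> \<ge> (\<Sum>\<tau>\<in>X. 1 / 2)"
  proof (rule sum_mono)
    fix \<tau> assume "\<tau> \<in> X"
    then have "real (gap \<tau>) \<le> 2 * real (card (mid \<tau>))" "0 < gap \<tau>"
      using card_mid gap_pos by fastforce+
    then show "1 / 2 \<le> real (card (mid \<tau>)) / real (gap \<tau>)" by (simp add: field_simps)
  qed
  finally show ?thesis by simp
qed

text \<open>The contribution of a pair of tuples to the second moment of
  \<open>weight\<close>.\<close>

definition overlap :: "nat list \<Rightarrow> nat list \<Rightarrow> real" where
  "overlap \<tau> \<sigma> = real (card (mid \<tau> \<inter> mid \<sigma>)) / (real (gap \<tau>) * real (gap \<sigma>))"

lemma overlap_nonneg: "0 \<le> overlap \<tau> \<sigma>"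
  unfolding overlap_def by simp

lemma overlap_sym: "overlap \<tau> \<sigma> = overlap \<sigma> \<tau>"
  unfolding overlap_def by (simp add: Int_commute mult.commute)

text \<open>Each \<sigma> of smaller gap contributes at most 1 / gap \<tau>, since the intersection
  has at most gap \<sigma> points. Those that contribute have distinct left ends in a range of fewer
  than 2 gap \<tau> points.\<close>

lemma sum_overlap_smaller:
  assumes "\<tau> \<in> X"
  shows "(\<Sum>\<sigma>\<in>{\<sigma>\<in>X. gap \<sigma> \<le> gap \<tau>}. overlap \<tau> \<sigma>) \<le> 2"
proof -
  let ?Y = "{\<sigma>\<in>X. gap \<sigma> \<le> gap \<tau> \<and> mid \<tau> \<inter> mid \<sigma> \<noteq> {}}"
  have fin: "finite ?Y" using finite_X by simp
  have "(\<Sum>\<sigma>\<in>{\<sigma>\<in>X. gap \<sigma> \<le> gap \<tau>}. overlap \<tau> \<sigma>) = (\<Sum>\<sigma>\<in>?Y. overlap \<tau> \<sigma>)"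
    using finite_X by (intro sum.mono_neutral_right) (auto simp: overlap_def)
  also have "\<dots> \<le> (\<Sum>\<sigma>\<in>?Y. 1 / real (gap \<tau>))"
  proof (rule sum_mono)
    fix \<sigma> assume "\<sigma> \<in> ?Y"
    then have s: "\<sigma> \<in> X" by simp
    have "card (mid \<tau> \<inter> mid \<sigma>) \<le> card (mid \<sigma>)"
      unfolding mid_def by (intro card_mono) auto
    then have "real (card (mid \<tau> \<inter> mid \<sigma>)) \<le> real (gap \<sigma>)"
      using card_mid[OF s] by linarith
    then show "overlap \<tau> \<sigma> \<le> 1 / real (gap \<tau>)"
      unfolding overlap_def using gap_pos[OF s] gap_pos[OF assms] by (simp add: field_simps)
  qed
  also have "\<dots> = real (card ?Y) / real (gap \<tau>)" by simp
  also have "\<dots> \<le> 2"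
  proof -
    have "left ` ?Y \<subseteq> {left \<tau> + 1 - gap \<tau>..<right \<tau>}"
    proof (rule image_subsetI)
      fix \<sigma> assume "\<sigma> \<in> ?Y"
      then obtain l where s: "\<sigma> \<in> X" "gap \<sigma> \<le> gap \<tau>" "l \<in> mid \<tau>" "l \<in> mid \<sigma>"
        by auto
      have "left \<tau> \<le> l" "l < right \<tau>" "left \<sigma> \<le> l" "l < left \<sigma> + gap \<sigma>"
        using mid_bounds[OF assms s(3)] mid_bounds[OF s(1,4)] right_eq[OF s(1)] by linarith+
      then show "left \<sigma> \<in> {left \<tau> + 1 - gap \<tau>..<right \<tau>}" using s(2) by auto
    qed
    then have "card (left ` ?Y) \<le> right \<tau> - (left \<tau> + 1 - gap \<tau>)"
      using card_mono[of "{left \<tau> + 1 - gap \<tau>..<right \<tau>}" "left ` ?Y"] by simp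
    moreover have "card (left ` ?Y) = card ?Y"
      by (rule card_image) (rule inj_on_subset[OF inj_left], auto)
    ultimately have "card ?Y \<le> 2 * gap \<tau>" using right_eq[OF assms] by linarith
    then have "real (card ?Y) \<le> 2 * real (gap \<tau>)" by linarith
    then show ?thesis using gap_pos[OF assms] by (simp add: field_simps)
  qed
  finally show ?thesis .
qed

text \<open>The square expands into the overlaps of all pairs. Charging a pair to its tuple of
  larger gap bounds the pairs of either order by 2 card X.\<close>

lemma sum_weight_squared: "(\<Sum>l\<in>{a..b}. (weight l)\<^sup>2) \<le> 4 * real (card X)"
proof -
  let ?w = "\<lambda>\<tau> l. indicator (mid \<tau>) l / real (gap \<tau>)"
  have "(\<Sum>l\<in>{a..b}. (weight l)\<^sup>2) = (\<Sum>l\<in>{a..b}. \<Sum>\<tau>\<in>X. \<Sum>\<sigma>\<in>X. ?w \<tau> l * ?w \<sigma> l)"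
    unfolding weight_def power2_eq_square sum_product ..
  also have "\<dots> = (\<Sum>\<tau>\<in>X. \<Sum>\<sigma>\<in>X. \<Sum>l\<in>{a..b}. ?w \<tau> l * ?w \<sigma> l)"
    by (subst sum.swap, rule sum.cong[OF refl], subst sum.swap) (rule refl)
  also have "\<dots> = (\<Sum>\<tau>\<in>X. \<Sum>\<sigma>\<in>X. overlap \<tau> \<sigma>)"
  proof (intro sum.cong refl)
    fix \<tau> \<sigma> assume t: "\<tau> \<in> X" "\<sigma> \<in> X"
    have "(\<Sum>l\<in>{a..b}. ?w \<tau> l * ?w \<sigma> l) =
        (\<Sum>l\<in>{a..b}. indicator (mid \<tau> \<inter> mid \<sigma>) l) / (real (gap \<tau>) * real (gap \<sigma>))"
      unfolding sum_divide_distrib by (intro sum.cong) (auto simp: indicator_def)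
    also have "(\<Sum>l\<in>{a..b}. indicator (mid \<tau> \<inter> mid \<sigma>) l) = real (card (mid \<tau> \<inter> mid \<sigma>))"
      using mid_subset[OF t(1)] by (simp add: indicator_def sum_of_bool_eq Int_absorb1 le_infI1 del: Int_iff)
    finally show "(\<Sum>l\<in>{a..b}. ?w \<tau> l * ?w \<sigma> l) = overlap \<tau> \<sigma>"
      unfolding overlap_def .
  qed
  also have "\<dots> \<le> (\<Sum>\<tau>\<in>X. \<Sum>\<sigma>\<in>X. (if gap \<sigma> \<le> gap \<tau> then overlap \<tau> \<sigma> else 0)
      + (if gap \<tau> \<le> gap \<sigma> then overlap \<tau> \<sigma> else 0))"
    by (intro sum_mono) (auto simp: overlap_nonneg)
  also have "\<dots> = (\<Sum>\<tau>\<in>X. \<Sum>\<sigma>\<in>X. if gap \<sigma> \<le> gap \<tau> then overlap \<tau> \<sigma> else 0)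
      + (\<Sum>\<tau>\<in>X. \<Sum>\<sigma>\<in>X. if gap \<tau> \<le> gap \<sigma> then overlap \<tau> \<sigma> else 0)"
    by (simp add: sum.distrib)
  also have "(\<Sum>\<tau>\<in>X. \<Sum>\<sigma>\<in>X. if gap \<tau> \<le> gap \<sigma> then overlap \<tau> \<sigma> else 0) =
      (\<Sum>\<tau>\<in>X. \<Sum>\<sigma>\<in>X. if gap \<sigma> \<le> gap \<tau> then overlap \<tau> \<sigma> else 0)"
    by (subst sum.swap) (simp add: overlap_sym cong: if_cong)
  also have "(\<Sum>\<tau>\<in>X. \<Sum>\<sigma>\<in>X. if gap \<sigma> \<le> gap \<tau> then overlap \<tau> \<sigma> else 0) \<le> (\<Sum>\<tau>\<in>X. 2)"
  proof (rule sum_mono)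
    fix \<tau> assume "\<tau> \<in> X"
    then show "(\<Sum>\<sigma>\<in>X. if gap \<sigma> \<le> gap \<tau> then overlap \<tau> \<sigma> else 0) \<le> 2"
      using sum_overlap_smaller[of \<tau>] finite_X by (simp add: sum.inter_filter)
  qed
  finally show ?thesis by simp
qed

text \<open>With N = card X, points below the threshold carry at most N / 4 of the total weight,
  which is at least N / 2; the second moment keeps the rest from sitting on few points.\<close>

lemma many_heavy_points:
  assumes "a \<le> b"
  shows "real (card X) / 64 \<le>
    real (card {l\<in>{a..b}. real (card X) / (4 * real (card {a..b})) \<le> weight l})"
proof -
  define \<theta> where "\<theta> = real (card X) / (4 * real (card {a..b}))"
  let ?G = "{l\<in>{a..b}. \<theta> \<le> weight l}"
  have \<theta>: "0 \<le> \<theta>" "real (card {a..b}) * \<theta> = real (card X) / 4"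
    using assms unfolding \<theta>_def by (simp_all add: field_simps)
  have nonneg: "0 \<le> weight l" for l
    unfolding weight_def by (intro sum_nonneg) auto
  have "real (card X) / 2 \<le> (\<Sum>l\<in>{a..b}. weight l)" by (rule sum_weight)
  also have "\<dots> \<le> (\<Sum>l\<in>{a..b}. \<theta> + (if l \<in> ?G then (weight l)\<^sup>2 / 32 + 8 else 0))"
  proof (rule sum_mono)
    fix l assume "l \<in> {a..b}"
    \<comment> \<open>This square linearizes the second moment. The denominator 32 makes it cost N /
      8, so 8 card G \<ge> N / 2 - N / 4 - N / 8, the origin of 64.\<close>
    have "0 \<le> (weight l - 16)\<^sup>2" by simp
    then have "weight l \<le> (weight l)\<^sup>2 / 32 + 8" by (simp add: power2_diff)
    moreover note \<theta>(1) nonneg[of l]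
    ultimately show "weight l \<le> \<theta> + (if l \<in> ?G then (weight l)\<^sup>2 / 32 + 8 else 0)"
      using \<open>l \<in> {a..b}\<close> by auto
  qed
  also have "\<dots> = real (card X) / 4 + (\<Sum>l\<in>?G. (weight l)\<^sup>2 / 32 + 8)"
  proof -
    have "(\<Sum>l\<in>{a..b}. if l \<in> ?G then (weight l)\<^sup>2 / 32 + 8 else 0) = (\<Sum>l\<in>?G. (weight l)\<^sup>2 / 32 + 8)"
      by (subst sum.inter_filter) (auto intro!: sum.cong)
    then show ?thesis
      using \<theta>(2) by (simp only: sum.distrib[of "\<lambda>_. \<theta>"] sum_constant)
  qed
  also have "(\<Sum>l\<in>?G. (weight l)\<^sup>2 / 32 + 8) = (\<Sum>l\<in>?G. (weight l)\<^sup>2) / 32 + 8 * real (card ?G)"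
    by (simp add: sum.distrib sum_divide_distrib)
  also have "(\<Sum>l\<in>?G. (weight l)\<^sup>2) \<le> (\<Sum>l\<in>{a..b}. (weight l)\<^sup>2)"
    by (intro sum_mono2) auto
  also have "\<dots> \<le> 4 * real (card X)" by (rule sum_weight_squared)
  finally show ?thesis unfolding \<theta>_def[symmetric] by simp
qed

section \<open>Dyadic levels of gaps around a point\<close>

definition level :: "nat list \<Rightarrow> nat" where "level \<tau> = Suc (floor_log (gap \<tau>))"
definition around :: "nat \<Rightarrow> nat \<Rightarrow> nat list set" where
  "around l t = {\<tau>\<in>X. l \<in> mid \<tau> \<and> level \<tau> = t}"

text \<open>The \<open>Suc\<close> in \<open>level\<close> makes 2 ^ t exceed the gap, so radius 2 ^
  t around l reaches both ends of every gap at level t that has l in its middle part.\<close>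

lemma level_bounds: "\<tau> \<in> X \<Longrightarrow> gap \<tau> < 2 ^ level \<tau> \<and> 2 ^ level \<tau> \<le> 2 * gap \<tau>"
  unfolding level_def using floor_log_exp2_gt[of "gap \<tau>"] floor_log_exp2_le[of "gap \<tau>"] gap_pos[of \<tau>]
  by simp

lemma finite_around: "finite (around l t)"
  unfolding around_def using finite_X by simp

lemma weight_le_levels:
  assumes "\<And>\<tau>. \<tau> \<in> X \<Longrightarrow> level \<tau> \<le> T"
  shows "weight l \<le> (\<Sum>t<Suc T. 2 * real (card (around l t)) / 2 ^ t)"
proof -
  have "weight l = (\<Sum>\<tau>\<in>{\<tau>\<in>X. l \<in> mid \<tau>}. 1 / real (gap \<tau>))"
    unfolding weight_def using finite_X by (auto simp: sum.inter_filter indicator_def intro!: sum.cong)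
  also have "\<dots> = (\<Sum>t<Suc T. \<Sum>\<tau>\<in>{\<tau>\<in>{\<tau>\<in>X. l \<in> mid \<tau>}. level \<tau> = t}. 1 / real (gap \<tau>))"
    using assms finite_X by (intro sum.group[symmetric]) (auto simp: less_Suc_eq_le)
  also have "\<dots> \<le> (\<Sum>t<Suc T. \<Sum>\<tau>\<in>{\<tau>\<in>{\<tau>\<in>X. l \<in> mid \<tau>}. level \<tau> = t}. 2 / 2 ^ t)"
  proof (intro sum_mono)
    fix t \<tau> assume "\<tau> \<in> {\<tau>\<in>{\<tau>\<in>X. l \<in> mid \<tau>}. level \<tau> = t}"
    then have "\<tau> \<in> X" "2 ^ t \<le> 2 * gap \<tau>" using level_bounds by auto
    moreover from this have "real (2 ^ t) \<le> real (2 * gap \<tau>)" by (intro of_nat_mono)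
    ultimately show "1 / real (gap \<tau>) \<le> 2 / 2 ^ t"
      using gap_pos[of \<tau>] by (simp add: field_simps)
  qed
  also have "\<dots> = (\<Sum>t<Suc T. 2 * real (card (around l t)) / 2 ^ t)"
    unfolding around_def by (simp add: conj_assoc mult.commute)
  finally show ?thesis .
qed

lemma right_around:
  assumes "\<tau> \<in> around l t"
  shows "l \<le> right \<tau>" "right \<tau> \<le> l + 2 ^ t"
  using assms mid_bounds[of \<tau> l] right_eq[of \<tau>] level_bounds[of \<tau>] unfolding around_def
  by auto

lemma card_right_around: "card (right ` around l t) = card (around l t)"
  by (intro card_image inj_on_subset[OF inj_right]) (auto simp: around_def)

text \<open>A separation of k + 6 levels gives the ratio 8 (k + 2) of \<open>nested\<close>: 2 ^ (k
  + 6) is at least 16 (k + 2), and the spare factor 2 pays for gaps that a level determines only up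
  to a factor 2.\<close>

lemma growth:
  assumes "\<sigma> \<in> around l t" "\<tau> \<in> around l t'" "t + (k + 6) \<le> t'"
  shows "right \<sigma> < right \<tau> \<and> f (right \<sigma>) < f (right \<tau>)"
proof (rule nested)
  show m: "\<tau> \<in> X" "\<sigma> \<in> X" "l \<in> mid \<tau>" "l \<in> mid \<sigma>"
    using assms unfolding around_def by auto
  have "16 * (k + 2) \<le> 64 * (k + 1)" by simp
  also have "\<dots> \<le> 64 * 2 ^ k" by (rule mult_le_mono2) (metis Suc_eq_plus1 Suc_leI less_exp)
  finally have "16 * (k + 2) \<le> 2 ^ (k + 6)" by (simp add: power_add)
  then have "16 * (k + 2) * gap \<sigma> \<le> 2 ^ (k + 6) * 2 ^ t"
    using level_bounds[OF m(2)] assms(1) unfolding around_def by (intro mult_mono) auto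
  also have "\<dots> \<le> 2 ^ t'"
    using assms(3) by (simp add: power_add[symmetric] add.commute del: power_add)
  also have "\<dots> \<le> 2 * gap \<tau>"
    using level_bounds[OF m(1)] assms(2) unfolding around_def by auto
  finally show "8 * (k + 2) * gap \<sigma> \<le> gap \<tau>" by (simp add: add_mult_distrib)
qed

text \<open>Cutting the family at the median of \<^term>\<open>\<lambda>\<tau>. f (left \<tau>)\<close> makes every remaining prefix
  compatible with every remaining suffix.\<close>

lemma median_split:
  assumes Y: "Y \<subseteq> around l t" "Y \<noteq> {}"
  obtains S\<^sub>1 S\<^sub>2 where
    "S\<^sub>1 \<subseteq> \<Union>(set ` X) \<inter> {l - (k + 1) * 2 ^ t..l + (k + 1) * 2 ^ t}"
    "S\<^sub>2 \<subseteq> \<Union>(set ` X) \<inter> {l - (k + 1) * 2 ^ t..l + (k + 1) * 2 ^ t}"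
    "hitting_at_least f c S\<^sub>1 (real (card Y) / 2)"
    "hitting_at_least f (k - c) S\<^sub>2 (real (card Y) / 2)"
    "\<And>x y. x \<in> S\<^sub>1 \<Longrightarrow> y \<in> S\<^sub>2 \<Longrightarrow> x < y \<and> f x < f y"
proof -
  have YX: "\<tau> \<in> X" "l \<in> mid \<tau>" "gap \<tau> \<le> 2 ^ t" if "\<tau> \<in> Y" for \<tau>
    using that Y(1) level_bounds[of \<tau>] unfolding around_def by auto
  have fin: "finite Y" using Y(1) finite_around finite_subset by blast
  obtain m where m: "card Y \<le> 2 * card {\<tau>\<in>Y. f (left \<tau>) \<le> m}"
      "card Y \<le> 2 * card {\<tau>\<in>Y. m \<le> f (left \<tau>)}"
    using exists_median[OF fin Y(2), of "\<lambda>\<tau>. f (left \<tau>)"] by blast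
  define L where "L = {\<tau>\<in>Y. f (left \<tau>) \<le> m}"
  define R where "R = {\<tau>\<in>Y. m \<le> f (left \<tau>)}"
  \<comment> \<open>At most k gaps within a prefix or suffix, and one more gap to reach l.\<close>
  have kg: "k * gap \<tau> + gap \<tau> \<le> (k + 1) * 2 ^ t" if "\<tau> \<in> Y" for \<tau>
    using mult_le_mono2[OF YX(3)[OF that], of "k + 1"] by simp
  show thesis
  proof (rule that[of "\<Union>\<tau>\<in>L. set (take c \<tau>)" "\<Union>\<tau>\<in>R. set (drop c \<tau>)"])
    show "(\<Union>\<tau>\<in>L. set (take c \<tau>)) \<subseteq> \<Union>(set ` X) \<inter> {l - (k + 1) * 2 ^ t..l + (k + 1) * 2 ^ t}"
    proof
      fix x assume "x \<in> (\<Union>\<tau>\<in>L. set (take c \<tau>))"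
      then obtain \<tau> where \<tau>: "\<tau> \<in> Y" "x \<in> set (take c \<tau>)" unfolding L_def by auto
      note t = YX[OF \<tau>(1)]
      have "l \<le> x + (k + 1) * 2 ^ t" "x \<le> l"
        using prefix_bounds[OF t(1) \<tau>(2)] mid_bounds[OF t(1,2)] right_eq[OF t(1)] kg[OF \<tau>(1)]
        by linarith+
      then show "x \<in> \<Union>(set ` X) \<inter> {l - (k + 1) * 2 ^ t..l + (k + 1) * 2 ^ t}"
        using t(1) in_set_takeD[OF \<tau>(2)] by (auto simp: le_diff_conv)
    qed
    show "(\<Union>\<tau>\<in>R. set (drop c \<tau>)) \<subseteq> \<Union>(set ` X) \<inter> {l - (k + 1) * 2 ^ t..l + (k + 1) * 2 ^ t}"
    proof
      fix x assume "x \<in> (\<Union>\<tau>\<in>R. set (drop c \<tau>))"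
      then obtain \<tau> where \<tau>: "\<tau> \<in> Y" "x \<in> set (drop c \<tau>)" unfolding R_def by auto
      note t = YX[OF \<tau>(1)]
      have "x \<le> l + (k + 1) * 2 ^ t" "l \<le> x"
        using suffix_bounds[OF t(1) \<tau>(2)] mid_bounds[OF t(1,2)] right_eq[OF t(1)] kg[OF \<tau>(1)]
        by linarith+
      then show "x \<in> \<Union>(set ` X) \<inter> {l - (k + 1) * 2 ^ t..l + (k + 1) * 2 ^ t}"
        using t(1) in_set_dropD[OF \<tau>(2)] by (auto simp: le_diff_conv)
    qed
    have sub: "L \<subseteq> X" "R \<subseteq> X" "finite L" "finite R"
      using YX(1) fin unfolding L_def R_def by auto
    show "hitting_at_least f c (\<Union>\<tau>\<in>L. set (take c \<tau>)) (real (card Y) / 2)"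
    proof (rule hitting_at_least_disjoint_family[of L "take c"])
      fix \<tau> \<sigma> assume "\<tau> \<in> L" "\<sigma> \<in> L" "\<tau> \<noteq> \<sigma>"
      then show "set (take c \<tau>) \<inter> set (take c \<sigma>) = {}"
        using disjoint[of \<tau> \<sigma>] sub by (auto dest!: in_set_takeD)
    qed (use sub m(1) tuple c in \<open>auto simp: L_def[symmetric] intro!: sorted_wrt_take\<close>)
    show "hitting_at_least f (k - c) (\<Union>\<tau>\<in>R. set (drop c \<tau>)) (real (card Y) / 2)"
    proof (rule hitting_at_least_disjoint_family[of R "drop c"])
      fix \<tau> \<sigma> assume "\<tau> \<in> R" "\<sigma> \<in> R" "\<tau> \<noteq> \<sigma>"
      then show "set (drop c \<tau>) \<inter> set (drop c \<sigma>) = {}"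
        using disjoint[of \<tau> \<sigma>] sub by (auto dest!: in_set_dropD)
    qed (use sub m(2) tuple c in \<open>auto simp: R_def[symmetric] intro!: sorted_wrt_drop\<close>)
    \<comment> \<open>The point l lies in all the gaps and separates positions, while m separates
      values; strictness comes from f (left \<sigma>) < f (right \<sigma>).\<close>
    fix x y assume "x \<in> (\<Union>\<tau>\<in>L. set (take c \<tau>))" "y \<in> (\<Union>\<tau>\<in>R. set (drop c \<tau>))"
    then obtain \<tau> \<sigma> where \<tau>: "\<tau> \<in> Y" "f (left \<tau>) \<le> m" "x \<in> set (take c \<tau>)"
      and \<sigma>: "\<sigma> \<in> Y" "m \<le> f (left \<sigma>)" "y \<in> set (drop c \<sigma>)"
      unfolding L_def R_def by auto
    show "x < y \<and> f x < f y"
      using prefix_bounds[OF YX(1)[OF \<tau>(1)] \<tau>(3)] suffix_bounds[OF YX(1)[OF \<sigma>(1)] \<sigma>(3)]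
        mid_bounds[OF YX(1,2)[OF \<tau>(1)]] mid_bounds[OF YX(1,2)[OF \<sigma>(1)]]
        left_less_right[OF YX(1)[OF \<sigma>(1)]] \<tau>(2) \<sigma>(2) by linarith
  qed
qed

text \<open>Near the ends of [a, b] a window may be cut off. The gap of \<tau> lies within [a, b]
  and within radius 2 ^ t of l, so a window of comparable size survives.\<close>

lemma card_window:
  assumes "\<tau> \<in> around l t" "2 ^ t \<le> r"
  shows "2 ^ t \<le> 2 * card ({a..b} \<inter> {l - r..l + r})"
proof -
  have \<tau>: "\<tau> \<in> X" "l \<in> mid \<tau>" "level \<tau> = t" using assms unfolding around_def by auto
  have "{left \<tau>..<right \<tau>} \<subseteq> {a..b} \<inter> {l - r..l + r}"
    using left_range[OF \<tau>(1)] right_range[OF \<tau>(1)] mid_bounds[OF \<tau>(1,2)]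
      right_eq[OF \<tau>(1)] level_bounds[OF \<tau>(1)] \<tau>(3) assms(2) by auto
  then have "card {left \<tau>..<right \<tau>} \<le> card ({a..b} \<inter> {l - r..l + r})"
    by (intro card_mono) auto
  then show ?thesis
    using level_bounds[OF \<tau>(1)] \<tau>(3) unfolding gap_def by simp
qed

end

section \<open>Independent unions of query lists\<close>

definition join :: "nat list pmf \<Rightarrow> nat list pmf \<Rightarrow> nat list pmf" where
  "join M N = do {u \<leftarrow> M; v \<leftarrow> N; return_pmf (u @ v)}"

primrec unions :: "('a \<Rightarrow> nat list pmf) \<Rightarrow> 'a list \<Rightarrow> nat list pmf" where
  "unions F [] = return_pmf []"
| "unions F (t # ts) = join (F t) (unions F ts)"

lemma join_eq_map_pair: "join M N = map_pmf (\<lambda>(u, v). u @ v) (pair_pmf M N)"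
  unfolding join_def pair_pmf_def by (simp add: map_pmf_def bind_assoc_pmf bind_return_pmf)

lemma set_join: "set_pmf (join M N) = {u @ v |u v. u \<in> set_pmf M \<and> v \<in> set_pmf N}"
  unfolding join_eq_map_pair by auto

lemma join_assoc: "join (join M N) K = join M (join N K)"
  unfolding join_def by (simp add: bind_assoc_pmf bind_return_pmf)

lemma unions_append: "unions F (ts @ us) = join (unions F ts) (unions F us)"
proof (induction ts)
  case Nil
  then show ?case by (simp add: join_def bind_return_pmf bind_return_pmf')
qed (simp add: join_assoc)

lemma prob_pair:
  "measure_pmf.prob (pair_pmf M N) {(u, v). P u \<and> Q v} =
    measure_pmf.prob M {u. P u} * measure_pmf.prob N {v. Q v}" for M N :: "nat list pmf"
proof -
  have "{(u, v). P u \<and> Q v} = {u. P u} \<times> {v. Q v}" by auto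
  then show ?thesis by (simp add: measure_pmf_prob_product)
qed

lemma prob_join_ge:
  assumes "\<And>u v. P u \<Longrightarrow> Q v \<Longrightarrow> R (u @ v)"
  shows "measure_pmf.prob M {u. P u} * measure_pmf.prob N {v. Q v} \<le> measure_pmf.prob (join M N) {w. R w}"
  unfolding prob_pair[symmetric] join_eq_map_pair measure_map_pmf
  by (rule measure_pmf.finite_measure_mono) (auto simp: assms)

lemma prob_join_le:
  assumes "\<And>u v. R (u @ v) \<Longrightarrow> P u \<and> Q v"
  shows "measure_pmf.prob (join M N) {w. R w} \<le> measure_pmf.prob M {u. P u} * measure_pmf.prob N {v. Q v}"
  unfolding prob_pair[symmetric] join_eq_map_pair measure_map_pmf
  by (rule measure_pmf.finite_measure_mono) (auto dest: assms)

lemma mono_predD: "mono P \<Longrightarrow> A \<subseteq> B \<Longrightarrow> P A \<Longrightarrow> P B" for P :: "'a set \<Rightarrow> bool"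
  by (auto dest: monoD)

lemma mono_contains: "mono (\<lambda>A. contains_ascending f k (A \<inter> S))"
  by (intro monoI) (auto elim!: contains_ascending_mono)

lemma mono_hits: "mono (\<lambda>A. A \<inter> D \<noteq> {})"
  by (intro monoI) auto

text \<open>Only monotone events on the set of queries are considered: further queries never hurt,
  so a part of a union may be analysed alone.\<close>

lemma prob_join_left:
  assumes "mono P"
  shows "measure_pmf.prob M {u. P (set u)} \<le> measure_pmf.prob (join M N) {w. P (set w)}"
  using prob_join_ge[of "\<lambda>u. P (set u)" "\<lambda>_. True" "\<lambda>w. P (set w)" M N]
    mono_predD[OF assms] by simp (metis Un_upper1)

lemma prob_join_right:
  assumes "mono P"
  shows "measure_pmf.prob N {u. P (set u)} \<le> measure_pmf.prob (join M N) {w. P (set w)}"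
  using prob_join_ge[of "\<lambda>_. True" "\<lambda>u. P (set u)" "\<lambda>w. P (set w)" M N]
    mono_predD[OF assms] by simp (metis Un_upper2)

lemma prob_unions_mem:
  assumes mono: "mono P" and "t \<in> set ts"
  shows "measure_pmf.prob (F t) {u. P (set u)} \<le> measure_pmf.prob (unions F ts) {w. P (set w)}"
  using assms(2)
proof (induction ts)
  case (Cons s ts)
  show ?case
  proof (cases "t = s")
    case True
    then show ?thesis using prob_join_left[of P, OF mono] by simp
  next
    case False
    then have "measure_pmf.prob (F t) {u. P (set u)} \<le> measure_pmf.prob (unions F ts) {w. P (set w)}"
      using Cons by simp
    also have "\<dots> \<le> measure_pmf.prob (unions F (s # ts)) {w. P (set w)}"
      using prob_join_right[of P, OF mono] by simp
    finally show ?thesis .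
  qed
qed simp

text \<open>A monotone event fails for a union only if it fails for every part, and the parts are
  independent.\<close>

lemma prob_fail_unions:
  assumes mono: "mono P"
  shows "measure_pmf.prob (unions F ts) {w. \<not> P (set w)} \<le>
    (\<Prod>t\<leftarrow>ts. measure_pmf.prob (F t) {u. \<not> P (set u)})"
proof (induction ts)
  case (Cons t ts)
  have "measure_pmf.prob (unions F (t # ts)) {w. \<not> P (set w)} \<le>
      measure_pmf.prob (F t) {u. \<not> P (set u)} * measure_pmf.prob (unions F ts) {w. \<not> P (set w)}"
    unfolding unions.simps by (rule prob_join_le) (use mono_predD[OF mono] in \<open>auto, blast+\<close>)
  also have "\<dots> \<le> measure_pmf.prob (F t) {u. \<not> P (set u)} * (\<Prod>t\<leftarrow>ts. measure_pmf.prob (F t) {u. \<not> P (set u)})"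
    by (rule mult_left_mono[OF Cons]) simp
  finally show ?case by simp
qed simp

lemma prob_not: "measure_pmf.prob M {u. \<not> P u} = 1 - measure_pmf.prob M {u. P u}"
proof -
  have "{u. \<not> P u} = UNIV - {u. P u}" by auto
  then show ?thesis using measure_pmf.prob_compl[of "{u. P u}" M] by simp
qed

text \<open>A rational substitute for the bound by exp (- s): each factor uses (1 - p) (1 + p + s)
  \<le> 1 + s.\<close>

lemma prod_one_minus_le:
  fixes p :: "'a \<Rightarrow> real"
  assumes "\<And>t. t \<in> set ts \<Longrightarrow> 0 \<le> p t \<and> p t \<le> 1"
  shows "(\<Prod>t\<leftarrow>ts. 1 - p t) * (1 + (\<Sum>t\<leftarrow>ts. p t)) \<le> 1 \<and> 0 \<le> (\<Prod>t\<leftarrow>ts. 1 - p t)"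
  using assms
proof (induction ts)
  case (Cons t ts)
  define s where "s = (\<Sum>t\<leftarrow>ts. p t)"
  have IH: "(\<Prod>t\<leftarrow>ts. 1 - p t) * (1 + s) \<le> 1" "0 \<le> (\<Prod>t\<leftarrow>ts. 1 - p t)" and pt: "0 \<le> p t" "p t \<le> 1"
    using Cons unfolding s_def by auto
  have s: "0 \<le> s" unfolding s_def by (rule sum_list_nonneg) (use Cons.prems in auto)
  have "(1 - p t) * (1 + (p t + s)) \<le> 1 + s"
    using pt s by (simp add: algebra_simps)
  then have "(\<Prod>t\<leftarrow>ts. 1 - p t) * ((1 - p t) * (1 + (p t + s))) \<le> (\<Prod>t\<leftarrow>ts. 1 - p t) * (1 + s)"
    using IH(2) by (rule mult_left_mono)
  then show ?case using IH pt unfolding s_def by (simp add: mult.commute mult.left_commute)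
qed simp

text \<open>Failure has probability at most 1 / (1 + s), which is at most 1 - s / 2 for s in
  [0, 1].\<close>

lemma prob_hit_unions:
  assumes mono: "mono P"
    and p: "\<And>t. t \<in> set ts \<Longrightarrow> 0 \<le> p t \<and> p t \<le> measure_pmf.prob (F t) {u. P (set u)}"
    and s: "s \<le> (\<Sum>t\<leftarrow>ts. p t)" "0 \<le> s" "s \<le> 1"
  shows "s / 2 \<le> measure_pmf.prob (unions F ts) {w. P (set w)}"
proof -
  let ?\<pi> = "\<Prod>t\<leftarrow>ts. 1 - p t"
  have "p t \<le> 1" if "t \<in> set ts" for t
    using p[OF that] measure_pmf.prob_le_1[of "F t" "{u. P (set u)}"] by linarith
  then have pi: "?\<pi> * (1 + (\<Sum>t\<leftarrow>ts. p t)) \<le> 1" "0 \<le> ?\<pi>"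
    using prod_one_minus_le[of ts p] p by auto
  have "?\<pi> * (1 + s) \<le> ?\<pi> * (1 + (\<Sum>t\<leftarrow>ts. p t))"
    using pi(2) s(1) by (intro mult_left_mono) auto
  then have "?\<pi> * (1 + s) \<le> 1" using pi(1) by linarith
  moreover have "1 \<le> (1 - s / 2) * (1 + s)"
  proof -
    have "s * s \<le> s * 1" using s by (intro mult_left_mono) auto
    then show ?thesis by (simp add: algebra_simps)
  qed
  ultimately have "?\<pi> * (1 + s) \<le> (1 - s / 2) * (1 + s)" by linarith
  then have "?\<pi> \<le> 1 - s / 2" using s(2) by simp
  moreover have "measure_pmf.prob (unions F ts) {w. \<not> P (set w)} \<le> ?\<pi>"
  proof (rule order_trans[OF prob_fail_unions[of P, OF mono]])
    show "(\<Prod>t\<leftarrow>ts. measure_pmf.prob (F t) {u. \<not> P (set u)}) \<le> ?\<pi>"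
      using p
    proof (induction ts)
      case (Cons t ts)
      then have "measure_pmf.prob (F t) {u. \<not> P (set u)} \<le> 1 - p t"
        by (simp add: prob_not)
      moreover from this have "0 \<le> 1 - p t" using measure_nonneg order_trans by blast
      moreover have "0 \<le> (\<Prod>t\<leftarrow>ts. measure_pmf.prob (F t) {u. \<not> P (set u)})"
        by (rule prod_list_nonneg) auto
      ultimately show ?case using Cons by (auto intro!: mult_mono)
    qed simp
  qed
  ultimately show ?thesis by (simp add: prob_not)
qed

text \<open>Scales are consumed in blocks. The shortest block with total at least \<alpha> is hit
  with probability at least \<alpha> / 2 and supplies one entry. As no single scale exceeds
  \<alpha>, this block uses up at most 2 \<alpha>; the d scales skipped after it, so that
  \<open>growth\<close> applies, use up at most d \<alpha>. Each entry thus costs at most (d + 2)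
  \<alpha>.\<close>

lemma prob_growing_chain:
  fixes D :: "nat \<Rightarrow> nat set" and p :: "nat \<Rightarrow> real"
  assumes hit: "\<And>t. t < j \<Longrightarrow> 0 \<le> p t \<and> p t \<le> \<alpha> \<and> p t \<le> measure_pmf.prob (F t) {u. set u \<inter> D t \<noteq> {}}"
    and growth: "\<And>t t' x y. \<lbrakk>t + d \<le> t'; x \<in> D t; y \<in> D t'\<rbrakk> \<Longrightarrow> x < y \<and> f x < f y"
    and \<alpha>: "0 < \<alpha>" "\<alpha> \<le> 1"
    and "i \<le> j"
    and total: "real m * real (d + 2) * \<alpha> \<le> (\<Sum>t\<in>{i..<j}. p t)"
  shows "(\<alpha> / 2) ^ m \<le> measure_pmf.prob (unions F [i..<j])
    {u. contains_ascending f m (set u \<inter> (\<Union>t\<in>{i..<j}. D t))}"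
  using total \<open>i \<le> j\<close>
proof (induction m arbitrary: i)
  case 0
  have "contains_ascending f 0 A" for A
    unfolding contains_ascending_def by simp
  then show ?case by simp
next
  case (Suc m)
  define e where "e = (LEAST e. \<alpha> \<le> (\<Sum>t\<in>{i..<e}. p t))"
  have "1 * \<alpha> \<le> real (Suc m) * real (d + 2) * \<alpha>"
  proof (rule mult_right_mono)
    have "1 * 1 \<le> real (Suc m) * real (d + 2)" by (rule mult_mono) auto
    then show "1 \<le> real (Suc m) * real (d + 2)" by simp
  qed (use \<alpha> in auto)
  then have ex: "\<alpha> \<le> (\<Sum>t\<in>{i..<j}. p t)"
    using Suc.prems(1) by linarith
  then have e: "\<alpha> \<le> (\<Sum>t\<in>{i..<e}. p t)" and "e \<le> j"
    unfolding e_def by (rule LeastI, rule Least_le)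
  have "i < e" using e \<alpha>(1) by (cases "i < e") auto
  have small: "(\<Sum>t\<in>{i..<e}. p t) \<le> 2 * \<alpha>"
  proof -
    obtain e' where e': "e = Suc e'" "i \<le> e'" using \<open>i < e\<close> by (cases e) auto
    have "\<not> \<alpha> \<le> (\<Sum>t\<in>{i..<e'}. p t)" using not_less_Least[of e' "\<lambda>e. \<alpha> \<le> (\<Sum>t\<in>{i..<e}. p t)"]
      unfolding e_def[symmetric] e' by simp
    moreover have "p e' \<le> \<alpha>" using hit e' \<open>e \<le> j\<close> by auto
    ultimately show ?thesis using e' by simp
  qed
  \<comment> \<open>The minimum covers the case that fewer than d scales are left.\<close>
  define i' where "i' = min (e + d) j"
  have i': "e \<le> i'" "i' \<le> j" "i' - e \<le> d" unfolding i'_def using \<open>e \<le> j\<close> by auto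
  have "(\<Sum>t\<in>{e..<i'}. p t) \<le> (\<Sum>t\<in>{e..<i'}. \<alpha>)"
    using hit i' by (intro sum_mono) auto
  also have "\<dots> \<le> real d * \<alpha>"
    using i'(3) \<alpha> by (simp add: mult_right_mono)
  finally have skip: "(\<Sum>t\<in>{e..<i'}. p t) \<le> real d * \<alpha>" .
  have "(\<Sum>t\<in>{i..<j}. p t) = (\<Sum>t\<in>{i..<e}. p t) + (\<Sum>t\<in>{e..<i'}. p t) + (\<Sum>t\<in>{i'..<j}. p t)"
    using \<open>i < e\<close> i' by (simp add: sum.atLeastLessThan_concat)
  then have "real m * real (d + 2) * \<alpha> \<le> (\<Sum>t\<in>{i'..<j}. p t)"
    using small skip Suc.prems(1) by (simp add: algebra_simps)
  from Suc.IH[OF this i'(2)] have IH: "(\<alpha> / 2) ^ m \<le> measure_pmf.prob (unions F [i'..<j])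
      {u. contains_ascending f m (set u \<inter> (\<Union>t\<in>{i'..<j}. D t))}" .
  have first: "\<alpha> / 2 \<le> measure_pmf.prob (unions F [i..<e]) {u. set u \<inter> (\<Union>t\<in>{i..<e}. D t) \<noteq> {}}"
  proof (rule prob_hit_unions[where p = p and P = "\<lambda>A. A \<inter> (\<Union>t\<in>{i..<e}. D t) \<noteq> {}"])
    fix t assume t: "t \<in> set [i..<e]"
    then have "D t \<subseteq> (\<Union>t\<in>{i..<e}. D t)" by auto
    then have "measure_pmf.prob (F t) {u. set u \<inter> D t \<noteq> {}} \<le>
        measure_pmf.prob (F t) {u. set u \<inter> (\<Union>t\<in>{i..<e}. D t) \<noteq> {}}"
      by (intro measure_pmf.finite_measure_mono) (blast, simp)
    then show "0 \<le> p t \<and> p t \<le> measure_pmf.prob (F t) {u. set u \<inter> (\<Union>t\<in>{i..<e}. D t) \<noteq> {}}"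
      using hit[of t] t \<open>e \<le> j\<close> by auto
  qed (use e \<alpha> mono_hits in \<open>auto simp: interv_sum_list_conv_sum_set_nat\<close>)
  have rest: "measure_pmf.prob (unions F [i'..<j]) {u. contains_ascending f m (set u \<inter> (\<Union>t\<in>{i'..<j}. D t))}
      \<le> measure_pmf.prob (unions F [e..<j]) {u. contains_ascending f m (set u \<inter> (\<Union>t\<in>{i'..<j}. D t))}"
  proof -
    have "[e..<j] = [e..<i'] @ [i'..<j]"
      using i' upt_add_eq_append[of e i' "j - i'"] by simp
    then have "unions F [e..<j] = join (unions F [e..<i']) (unions F [i'..<j])"
      by (simp only: unions_append)
    then show ?thesis
      using prob_join_right[OF mono_contains] by simp
  qed
  have "(\<alpha> / 2) ^ Suc m \<le> measure_pmf.prob (unions F [i..<e]) {u. set u \<inter> (\<Union>t\<in>{i..<e}. D t) \<noteq> {}} *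
      measure_pmf.prob (unions F [e..<j]) {u. contains_ascending f m (set u \<inter> (\<Union>t\<in>{i'..<j}. D t))}"
    unfolding power_Suc using first IH rest \<alpha> by (intro mult_mono) auto
  also have "\<dots> \<le> measure_pmf.prob (join (unions F [i..<e]) (unions F [e..<j]))
      {u. contains_ascending f (Suc m) (set u \<inter> (\<Union>t\<in>{i..<j}. D t))}"
  proof (rule prob_join_ge)
    fix u v assume u: "set u \<inter> (\<Union>t\<in>{i..<e}. D t) \<noteq> {}"
      and v: "contains_ascending f m (set v \<inter> (\<Union>t\<in>{i'..<j}. D t))"
    obtain x t where x: "x \<in> set u" "t \<in> {i..<e}" "x \<in> D t" using u by blast
    obtain xs where xs: "length xs = m" "set xs \<subseteq> set v \<inter> (\<Union>t\<in>{i'..<j}. D t)" "ascending f xs"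
      using v unfolding contains_ascending_def by blast
    have "x < y \<and> f x < f y" if y: "y \<in> set xs" for y
    proof -
      obtain t' where t': "t' \<in> {i'..<j}" "y \<in> D t'" using xs(2) y by blast
      have "t + d \<le> t'" using x(2) t'(1) unfolding i'_def by auto
      then show ?thesis using growth x(3) t'(2) by blast
    qed
    then have "ascending f (x # xs)" using xs(3) by simp
    moreover have "set (x # xs) \<subseteq> set (u @ v) \<inter> (\<Union>t\<in>{i..<j}. D t)"
      using x xs(2) \<open>e \<le> j\<close> \<open>i < e\<close> i' by fastforce
    ultimately show "contains_ascending f (Suc m) (set (u @ v) \<inter> (\<Union>t\<in>{i..<j}. D t))"
      unfolding contains_ascending_def using xs(1) by (intro exI[of _ "x # xs"]) auto
  qed
  also have "join (unions F [i..<e]) (unions F [e..<j]) = unions F [i..<j]"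
    unfolding unions_append[symmetric] using \<open>i < e\<close> \<open>e \<le> j\<close> upt_add_eq_append[of i e "j - e"] by simp
  finally show ?case .
qed

section \<open>The search procedure\<close>

definition sample :: "nat set \<Rightarrow> (nat \<Rightarrow> nat list pmf) \<Rightarrow> nat list pmf" where
  "sample J F = pmf_of_set J \<bind> F"

definition window :: "nat \<Rightarrow> nat \<Rightarrow> nat \<Rightarrow> nat set" where
  "window n x t = {1..n} \<inter> {x - 2 ^ t..x + 2 ^ t}"

text \<open>A distribution over lists of positions that never consults f, so non-adaptivity is built
  in. Here \<open>Suc (k div 2)\<close> is half of \<open>Suc (Suc k)\<close>; all scales up to T
  are tried because the right one depends on f.\<close>

fun search :: "nat \<Rightarrow> nat \<Rightarrow> nat \<Rightarrow> nat \<Rightarrow> nat list pmf" where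
  "search n T 0 x = return_pmf []"
| "search n T (Suc 0) x = return_pmf [x]"
| "search n T (Suc (Suc k)) x = join (search n T (Suc k) x)
     (unions (\<lambda>t. sample (window n x t) (\<lambda>y. search n T (Suc (k div 2)) y)) [0..<Suc T])"

fun search_cost :: "nat \<Rightarrow> nat \<Rightarrow> nat" where
  "search_cost T 0 = 0"
| "search_cost T (Suc 0) = 1"
| "search_cost T (Suc (Suc k)) = search_cost T (Suc k) + Suc T * search_cost T (Suc (k div 2))"

lemma window_props: "x \<in> {1..n} \<Longrightarrow> x \<in> window n x t" "finite (window n x t)" "window n x t \<subseteq> {1..n}"
  unfolding window_def by auto

lemma prob_sample:
  assumes "finite J" "J \<noteq> {}"
  shows "measure_pmf.prob (sample J F) A = (\<Sum>y\<in>J. measure_pmf.prob (F y) A) / real (card J)"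
proof -
  have "ennreal (measure_pmf.prob (sample J F) A) = (\<integral>\<^sup>+y. ennreal (measure_pmf.prob (F y) A) \<partial>pmf_of_set J)"
    unfolding sample_def measure_pmf.emeasure_eq_measure[symmetric] emeasure_bind_pmf ..
  also have "\<dots> = ennreal (measure_pmf.expectation (pmf_of_set J) (\<lambda>y. measure_pmf.prob (F y) A))"
    by (rule nn_integral_eq_integral) (auto intro!: measure_pmf.integrable_const_bound[of _ 1])
  also have "\<dots> = ennreal ((\<Sum>y\<in>J. measure_pmf.prob (F y) A) / real (card J))"
    using assms by (simp add: integral_pmf_of_set)
  finally show ?thesis
    by (subst (asm) ennreal_inj) (auto intro!: divide_nonneg_nonneg sum_nonneg)
qed

lemma set_unions_subset:
  "(\<And>t u. t \<in> set ts \<Longrightarrow> u \<in> set_pmf (F t) \<Longrightarrow> set u \<subseteq> B) \<Longrightarrow> u \<in> set_pmf (unions F ts) \<Longrightarrow> set u \<subseteq> B"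
proof (induction ts arbitrary: u)
  case (Cons t ts)
  obtain v w where "u = v @ w" "v \<in> set_pmf (F t)" "w \<in> set_pmf (unions F ts)"
    using Cons.prems(2) by (auto simp: set_join)
  moreover from this have "set w \<subseteq> B" using Cons by auto
  ultimately show ?case using Cons.prems(1)[of t v] by simp
qed simp

lemma length_unions:
  "(\<And>t u. t \<in> set ts \<Longrightarrow> u \<in> set_pmf (F t) \<Longrightarrow> length u \<le> L) \<Longrightarrow> u \<in> set_pmf (unions F ts) \<Longrightarrow>
    length u \<le> length ts * L"
proof (induction ts arbitrary: u)
  case (Cons t ts)
  obtain v w where "u = v @ w" "v \<in> set_pmf (F t)" "w \<in> set_pmf (unions F ts)"
    using Cons.prems(2) by (auto simp: set_join)
  moreover from this have "length w \<le> length ts * L" using Cons by auto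
  ultimately show ?case using Cons.prems(1)[of t v] by simp
qed simp

lemma set_sample:
  "finite J \<Longrightarrow> J \<noteq> {} \<Longrightarrow> set_pmf (sample J F) = (\<Union>y\<in>J. set_pmf (F y))"
  unfolding sample_def by simp

text \<open>A subsearch whose starting point lies in a set already queries a point of that set; the
  case without a dominating scale uses nothing else of its subsearches.\<close>

lemma search_mem: "0 < k \<Longrightarrow> u \<in> set_pmf (search n T k x) \<Longrightarrow> x \<in> set u"
  by (induction n T k x arbitrary: u rule: search.induct) (auto simp: set_join simp del: upt_Suc)

lemma search_inside:
  "x \<in> {1..n} \<Longrightarrow> u \<in> set_pmf (search n T k x) \<Longrightarrow> set u \<subseteq> {1..n} \<and> length u \<le> search_cost T k"
proof (induction n T k x arbitrary: u rule: search.induct)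
  case (3 n T k x)
  obtain v w where u: "u = v @ w" and v: "v \<in> set_pmf (search n T (Suc k) x)"
    and w: "w \<in> set_pmf (unions (\<lambda>t. sample (window n x t) (\<lambda>y. search n T (Suc (k div 2)) y)) [0..<Suc T])"
    using 3(4) by (auto simp: set_join simp del: upt_Suc)
  have s: "set z \<subseteq> {1..n} \<and> length z \<le> search_cost T (Suc (k div 2))"
    if z: "z \<in> set_pmf (sample (window n x t) (\<lambda>y. search n T (Suc (k div 2)) y))" for z t
  proof -
    have "window n x t \<noteq> {}" using window_props(1)[OF 3(3)] by auto
    then obtain y where "y \<in> window n x t" "z \<in> set_pmf (search n T (Suc (k div 2)) y)"
      using z window_props(2) by (auto simp: set_sample)
    then show ?thesis using 3(2) window_props(3) by blast
  qed
  have "set w \<subseteq> {1..n}" using s by (intro set_unions_subset[OF _ w]) auto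
  moreover have "length w \<le> length [0..<Suc T] * search_cost T (Suc (k div 2))"
    using s by (intro length_unions[OF _ w]) auto
  ultimately show ?case using 3(1)[OF 3(3) v] u by (simp del: upt_Suc)
qed auto

text \<open>A search contains the search for the previous length from the same point, so the
  searches for k - 1 and k div 2 also serve for shorter pieces.\<close>

lemma search_mono:
  assumes mono: "mono P" and "0 < k" "k \<le> k'"
  shows "measure_pmf.prob (search n T k x) {u. P (set u)} \<le> measure_pmf.prob (search n T k' x) {u. P (set u)}"
  using assms(3)
proof (induction k' rule: dec_induct)
  case (step m)
  obtain m' where "m = Suc m'" using step.hyps assms(2) by (cases m) auto
  then have "measure_pmf.prob (search n T m x) {u. P (set u)} \<le>
      measure_pmf.prob (search n T (Suc m) x) {u. P (set u)}"
    using prob_join_left[of P, OF mono] by (simp del: upt_Suc)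
  then show ?case using step.IH by linarith
qed simp

section \<open>Good starting points\<close>

abbreviation success :: "(nat \<Rightarrow> real) \<Rightarrow> nat \<Rightarrow> nat \<Rightarrow> nat \<Rightarrow> nat set \<Rightarrow> nat \<Rightarrow> real" where
  "success f n T k S x \<equiv> measure_pmf.prob (search n T k x) {u. contains_ascending f k (set u \<inter> S)}"

text \<open>One \<delta> is both the fraction of good starting points and their success probability,
  uniformly in f, n and the interval. S does not influence the search; demanding tuples inside S
  lets separately found pieces be concatenated.\<close>

definition findable :: "nat \<Rightarrow> real \<Rightarrow> real \<Rightarrow> bool" where
  "findable k \<epsilon> \<delta> \<longleftrightarrow> (\<forall>f n T a b S. n \<le> 2 ^ T \<longrightarrow> 1 \<le> a \<longrightarrow> a \<le> b \<longrightarrow> b \<le> n \<longrightarrow> S \<subseteq> {a..b} \<longrightarrow>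
     hitting_at_least f k S (\<epsilon> * real (card {a..b})) \<longrightarrow>
     \<delta> * real (card {a..b}) \<le> real (card {x\<in>{a..b}. \<delta> \<le> success f n T k S x}))"

lemma findableD:
  assumes "findable k \<epsilon> \<delta>" "n \<le> 2 ^ T" "1 \<le> a" "a \<le> b" "b \<le> n" "S \<subseteq> {a..b}"
    "hitting_at_least f k S (\<epsilon> * real (card {a..b}))"
  shows "\<delta> * real (card {a..b}) \<le> real (card {x\<in>{a..b}. \<delta> \<le> success f n T k S x})"
  using assms unfolding findable_def by blast

lemma findable_mono:
  assumes "findable k \<epsilon> \<delta>" "\<delta>' \<le> \<delta>"
  shows "findable k \<epsilon> \<delta>'"
  unfolding findable_def
proof (intro allI impI)
  fix f :: "nat \<Rightarrow> real" and n T a b :: nat and S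
  assume h: "n \<le> 2 ^ T" "1 \<le> a" "a \<le> b" "b \<le> n" "S \<subseteq> {a..b}"
    "hitting_at_least f k S (\<epsilon> * real (card {a..b}))"
  have "\<delta>' * real (card {a..b}) \<le> \<delta> * real (card {a..b})"
    using assms(2) by (intro mult_right_mono) auto
  also have "\<dots> \<le> real (card {x\<in>{a..b}. \<delta> \<le> success f n T k S x})"
    by (rule findableD[OF assms(1) h])
  also have "\<dots> \<le> real (card {x\<in>{a..b}. \<delta>' \<le> success f n T k S x})"
    using assms(2) by (intro of_nat_mono card_mono) auto
  finally show "\<delta>' * real (card {a..b}) \<le> real (card {x\<in>{a..b}. \<delta>' \<le> success f n T k S x})" .
qed

text \<open>S itself hits every singleton in it and hence is dense, and a search started in S
  succeeds with certainty.\<close>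

lemma findable_one: "findable 1 \<epsilon> \<epsilon>" if "\<epsilon> \<le> 1"
  unfolding findable_def
proof (intro allI impI)
  fix f :: "nat \<Rightarrow> real" and n T a b :: nat and S
  assume S: "S \<subseteq> {a..b}" and h: "hitting_at_least f 1 S (\<epsilon> * real (card {a..b}))"
  have "\<not> contains_ascending f 1 (S - S)"
    unfolding contains_ascending_def by auto
  then have "\<epsilon> * real (card {a..b}) \<le> real (card S)"
    using h finite_subset[OF S] unfolding hitting_at_least_def by force
  moreover have "S \<subseteq> {x\<in>{a..b}. \<epsilon> \<le> success f n T 1 S x}"
  proof
    fix x assume "x \<in> S"
    then have "contains_ascending f 1 (set [x] \<inter> S)"
      unfolding contains_ascending_def by (intro exI[of _ "[x]"]) auto
    then have "success f n T 1 S x = 1" by (simp add: indicator_def)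
    then show "x \<in> {x\<in>{a..b}. \<epsilon> \<le> success f n T 1 S x}" using \<open>x \<in> S\<close> S that by auto
  qed
  then have "card S \<le> card {x\<in>{a..b}. \<epsilon> \<le> success f n T 1 S x}"
    by (intro card_mono) auto
  ultimately show "\<epsilon> * real (card {a..b}) \<le> real (card {x\<in>{a..b}. \<epsilon> \<le> success f n T 1 S x})"
    by linarith
qed

lemma hitting_at_least_mono: "hitting_at_least f k S h \<Longrightarrow> h' \<le> h \<Longrightarrow> hitting_at_least f k S h'"
  unfolding hitting_at_least_def by force

lemma window_eq: "window n x t = {max 1 (x - 2 ^ t)..min n (x + 2 ^ t)}"
  unfolding window_def by auto

lemma card_window_le: "card (window n x t) \<le> 3 * 2 ^ t"
proof -
  have "card (window n x t) \<le> card {x - 2 ^ t..x + 2 ^ t}"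
    unfolding window_def by (intro card_mono) auto
  also have "\<dots> \<le> 2 * 2 ^ t + 1" by simp
  also have "\<dots> \<le> 3 * 2 ^ t" by simp
  finally show ?thesis .
qed

lemma exists_window:
  assumes "x \<in> {a..b}" "1 \<le> a" "b \<le> n" "n \<le> 2 ^ T" "b - a \<le> 2 ^ s"
  shows "\<exists>t<Suc T. {a..b} \<subseteq> window n x t \<and> card (window n x t) \<le> 3 * 2 ^ s"
\<comment> \<open>Scales beyond T are not searched, but T suffices then, because b - a is below n
  \<le> 2 ^ T.\<close>
proof (intro exI[of _ "min s T"] conjI)
  have "b - a \<le> 2 ^ min s T" using assms by (auto simp: min_def)
  then show "{a..b} \<subseteq> window n x (min s T)"
    using assms(1-3) unfolding window_def by (auto simp: le_diff_conv)
  have "card (window n x (min s T)) \<le> 3 * 2 ^ min s T" by (rule card_window_le)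
  also have "\<dots> \<le> 3 * 2 ^ s" by simp
  finally show "card (window n x (min s T)) \<le> 3 * 2 ^ s" .
qed simp

lemma sample_ge:
  assumes "finite J" "J \<noteq> {}" "G \<subseteq> J" "\<And>y. y \<in> G \<Longrightarrow> \<delta> \<le> measure_pmf.prob (F y) A"
  shows "\<delta> * real (card G) / real (card J) \<le> measure_pmf.prob (sample J F) A"
proof -
  have "\<delta> * real (card G) = (\<Sum>y\<in>G. \<delta>)" by simp
  also have "\<dots> \<le> (\<Sum>y\<in>G. measure_pmf.prob (F y) A)" using assms(4) by (rule sum_mono)
  also have "\<dots> \<le> (\<Sum>y\<in>J. measure_pmf.prob (F y) A)"
    using assms by (intro sum_mono2) auto
  finally show ?thesis
    unfolding prob_sample[OF assms(1,2)] by (rule divide_right_mono) simp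
qed

text \<open>A random start is good with probability at least \<delta>, and a good start succeeds
  with probability at least \<delta>.\<close>

lemma findable_sample:
  assumes "findable m \<epsilon> \<delta>" "0 \<le> \<delta>" "n \<le> 2 ^ T" "1 \<le> a" "a \<le> b" "b \<le> n" "S \<subseteq> {a..b}"
    "hitting_at_least f m S (\<epsilon> * real (card {a..b}))"
  shows "\<delta>\<^sup>2 \<le> measure_pmf.prob (sample {a..b} (search n T m)) {u. contains_ascending f m (set u \<inter> S)}"
proof -
  let ?G = "{x\<in>{a..b}. \<delta> \<le> success f n T m S x}"
  have "0 < card {a..b}" using assms(5) by simp
  have "\<delta> * (\<delta> * real (card {a..b})) \<le> \<delta> * real (card ?G)"
    using findableD[OF assms(1,3-8)] assms(2) by (rule mult_left_mono)
  then have "\<delta>\<^sup>2 \<le> \<delta> * real (card ?G) / real (card {a..b})"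
    using \<open>0 < card {a..b}\<close> by (simp only: pos_le_divide_eq of_nat_0_less_iff power2_eq_square mult.assoc)
  also have "\<dots> \<le> measure_pmf.prob (sample {a..b} (search n T m)) {u. contains_ascending f m (set u \<inter> S)}"
    using assms(5) by (intro sample_ge) auto
  finally show ?thesis .
qed

lemma search_unfold:
  assumes "2 \<le> k"
  shows "search n T k x = join (search n T (k - 1) x)
    (unions (\<lambda>t. sample (window n x t) (search n T (k div 2))) [0..<Suc T])"
proof -
  obtain k' where "k = Suc (Suc k')" using assms by (metis Suc_le_D numeral_2_eq_2 Suc_le_mono)
  then show ?thesis by (simp del: upt_Suc)
qed

lemma sample_mono:
  assumes mono: "mono P" and "0 < m" "m \<le> m'" "finite J" "J \<noteq> {}"
  shows "measure_pmf.prob (sample J (search n T m)) {u. P (set u)} \<le>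
    measure_pmf.prob (sample J (search n T m')) {u. P (set u)}"
  unfolding prob_sample[OF assms(4,5)]
  using search_mono[OF mono assms(2,3)] by (intro divide_right_mono sum_mono) auto

text \<open>The part \<^term>\<open>S\<^sub>1\<close> carrying the longer piece is searched recursively from the same
  starting point, so that only the shorter piece costs a choice of scale.\<close>

lemma heavy_light:
  assumes fh: "findable h \<epsilon> \<delta>" and fm: "findable m \<epsilon> \<delta>" and \<delta>: "0 \<le> \<delta>" and \<epsilon>: "0 \<le> \<epsilon>"
    and k: "0 < h" "h < k" "0 < m" "m \<le> k div 2"
    and n: "n \<le> 2 ^ T" "1 \<le> a" "a \<le> b" "b \<le> n" "b - a \<le> 2 ^ s"
    and M: "\<epsilon> * (3 * 2 ^ s) \<le> M"
    and S\<^sub>1: "S\<^sub>1 \<subseteq> {a..b}" "hitting_at_least f h S\<^sub>1 M"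
    and S\<^sub>2: "S\<^sub>2 \<subseteq> {a..b}" "hitting_at_least f m S\<^sub>2 M"
    and comb: "\<And>A. contains_ascending f h (A \<inter> S\<^sub>1) \<Longrightarrow> contains_ascending f m (A \<inter> S\<^sub>2) \<Longrightarrow>
      contains_ascending f k (A \<inter> S)"
  shows "\<delta> * real (card {a..b}) \<le> real (card {x\<in>{a..b}. \<delta> ^ 3 \<le> success f n T k S x})"
proof -
  \<comment> \<open>The window from which the shorter piece is sought can be larger than [a, b],
    with up to 3 * 2 ^ s points; M is large enough relative to that size.\<close>
  have hit: "hitting_at_least f j S' (\<epsilon> * real N)"
    if "hitting_at_least f j S' M" "N \<le> 3 * 2 ^ s" for j S' N
  proof (rule hitting_at_least_mono[OF that(1)])
    have "real N \<le> real (3 * 2 ^ s)" using that(2) by (rule of_nat_mono)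
    then have "\<epsilon> * real N \<le> \<epsilon> * (3 * 2 ^ s)" using \<epsilon> by (intro mult_left_mono) auto
    then show "\<epsilon> * real N \<le> M" using M by linarith
  qed
  have "(1::nat) \<le> 2 ^ s" by simp
  then have "card {a..b} \<le> 3 * 2 ^ s" using n(5) unfolding card_atLeastAtMost by linarith
  then have "\<delta> * real (card {a..b}) \<le> real (card {x\<in>{a..b}. \<delta> \<le> success f n T h S\<^sub>1 x})"
    using findableD[OF fh n(1-4) S\<^sub>1(1)] hit[OF S\<^sub>1(2)] by blast
  also have "\<dots> \<le> real (card {x\<in>{a..b}. \<delta> ^ 3 \<le> success f n T k S x})"
  proof (intro of_nat_mono card_mono subsetI)
    fix x assume "x \<in> {x\<in>{a..b}. \<delta> \<le> success f n T h S\<^sub>1 x}"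
    then have x: "x \<in> {a..b}" "\<delta> \<le> success f n T h S\<^sub>1 x" by auto
    let ?P = "\<lambda>A. contains_ascending f h (A \<inter> S\<^sub>1)" and ?Q = "\<lambda>A. contains_ascending f m (A \<inter> S\<^sub>2)"
    have P: "mono ?P" and Q: "mono ?Q" by (rule mono_contains)+
    obtain t where t: "t < Suc T" "{a..b} \<subseteq> window n x t" "card (window n x t) \<le> 3 * 2 ^ s"
      using exists_window[OF x(1) n(2,4,1,5)] by blast
    have win: "x \<in> window n x t" using t(2) x(1) by blast
    have "\<delta>\<^sup>2 \<le> measure_pmf.prob (sample (window n x t) (search n T m)) {u. ?Q (set u)}"
      unfolding window_eq
    proof (rule findable_sample[OF fm \<delta> n(1)])
      show "max 1 (x - 2 ^ t) \<le> min n (x + 2 ^ t)" using win unfolding window_eq by auto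
      show "S\<^sub>2 \<subseteq> {max 1 (x - 2 ^ t)..min n (x + 2 ^ t)}"
        using S\<^sub>2(1) t(2) unfolding window_eq by blast
      show "hitting_at_least f m S\<^sub>2 (\<epsilon> * real (card {max 1 (x - 2 ^ t)..min n (x + 2 ^ t)}))"
        using hit[OF S\<^sub>2(2)] t(3) unfolding window_eq by blast
    qed auto
    also have "\<dots> \<le> measure_pmf.prob (sample (window n x t) (search n T (k div 2))) {u. ?Q (set u)}"
      by (rule sample_mono[OF Q k(3,4) window_props(2)]) (use win in auto)
    also have "\<dots> \<le> measure_pmf.prob (unions (\<lambda>t. sample (window n x t) (search n T (k div 2))) [0..<Suc T])
        {u. ?Q (set u)}"
      using prob_unions_mem[OF Q, of t "[0..<Suc T]" "\<lambda>t. sample (window n x t) (search n T (k div 2))"] t(1)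
      by (simp del: upt_Suc)
    finally have light: "\<delta>\<^sup>2 \<le> \<dots>" .
    have "\<delta> \<le> measure_pmf.prob (search n T (k - 1) x) {u. ?P (set u)}"
      using x(2) search_mono[OF P, of h "k - 1" n T x] k by linarith
    \<comment> \<open>The factor \<delta> is for the longer piece from x, and its square for the
      shorter piece from a random point of the right window, independently.\<close>
    then have "\<delta> * \<delta>\<^sup>2 \<le> measure_pmf.prob (search n T (k - 1) x) {u. ?P (set u)} *
      measure_pmf.prob (unions (\<lambda>t. sample (window n x t) (search n T (k div 2))) [0..<Suc T]) {u. ?Q (set u)}"
      using light \<delta> by (intro mult_mono) auto
    also have "\<dots> \<le> success f n T k S x"
    proof -
      have "2 \<le> k" using k by linarith
      show ?thesis unfolding search_unfold[OF \<open>2 \<le> k\<close>]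
      proof (rule prob_join_ge)
        fix u v assume "?P (set u)" "?Q (set v)"
        then have "?P (set (u @ v))" "?Q (set (u @ v))"
          using mono_predD[OF P, of "set u" "set (u @ v)"]
              mono_predD[OF Q, of "set v" "set (u @ v)"] by auto
        then show "contains_ascending f k (set (u @ v) \<inter> S)" by (rule comb)
      qed
    qed
    finally show "x \<in> {x\<in>{a..b}. \<delta> ^ 3 \<le> success f n T k S x}"
      using x(1) by (simp add: power3_eq_cube power2_eq_square)
  qed auto
  finally show ?thesis .
qed

lemma contains_ascending_append:
  assumes "contains_ascending f c (A \<inter> S\<^sub>1)" "contains_ascending f d (A \<inter> S\<^sub>2)"
    and "\<And>x y. x \<in> S\<^sub>1 \<Longrightarrow> y \<in> S\<^sub>2 \<Longrightarrow> x < y \<and> f x < f y" "S\<^sub>1 \<union> S\<^sub>2 \<subseteq> S"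
  shows "contains_ascending f (c + d) (A \<inter> S)"
proof -
  obtain xs ys where "length xs = c" "set xs \<subseteq> A \<inter> S\<^sub>1" "ascending f xs"
      "length ys = d" "set ys \<subseteq> A \<inter> S\<^sub>2" "ascending f ys"
    using assms(1,2) unfolding contains_ascending_def by blast
  moreover from this have "ascending f (xs @ ys)"
    using assms(3) unfolding sorted_wrt_append by blast
  ultimately show ?thesis
    unfolding contains_ascending_def using assms(4) by (intro exI[of _ "xs @ ys"]) auto
qed

section \<open>Heavy points without and with a dominating scale\<close>

context gap_family
begin

lemma level_le:
  assumes "\<tau> \<in> X" "1 \<le> a" "b \<le> 2 ^ T"
  shows "level \<tau> \<le> T"
proof -
  have "gap \<tau> < b" using left_range[OF assms(1)] right_range[OF assms(1)] assms(2)
    unfolding gap_def by auto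
  then have "2 ^ level \<tau> < (2::nat) ^ Suc T"
    using level_bounds[OF assms(1)] assms(3) unfolding power_Suc by linarith
  then show ?thesis by (simp add: power_strict_increasing_iff del: power_Suc)
qed

text \<open>At scale t, a uniform point of the window is a right end at level t with probability at
  least card (around l t) / (3 * 2 ^ t). The assumption \<open>small\<close> caps this bound by
  \<alpha>, and \<open>heavy\<close> supplies the total k (k + 8) \<alpha> for a chain of k entries
  with separation d = k + 6. The factor 6 arises from 2 / 2 ^ t = 6 / (3 * 2 ^ t).\<close>

lemma growing_point:
  assumes n: "n \<le> 2 ^ T" "1 \<le> a" "b \<le> n" and l: "l \<in> {a..b}"
    and \<alpha>: "0 < \<alpha>" "\<alpha> \<le> 1"
    and small: "\<And>t. real (card (around l t)) \<le> 3 * \<alpha> * 2 ^ t"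
    and heavy: "6 * (real k * real (k + 8) * \<alpha>) \<le> weight l"
  shows "(\<alpha> / 2) ^ k \<le> success f n T k (\<Union>(set ` X)) l"
proof -
  let ?F = "\<lambda>t. sample (window n l t) (search n T (k div 2))"
  let ?p = "\<lambda>t. real (card (around l t)) / (3 * 2 ^ t)"
  let ?D = "\<lambda>t. right ` around l t"
  have k: "2 \<le> k" using c by simp
  have l': "l \<in> {1..n}" using l n by auto
  have lev: "level \<tau> \<le> T" if "\<tau> \<in> X" for \<tau>
    using level_le[OF that n(2), of T] n by linarith
  have "weight l \<le> (\<Sum>t<Suc T. 2 * real (card (around l t)) / 2 ^ t)"
    by (rule weight_le_levels[OF lev])
  also have "\<dots> = 6 * (\<Sum>t\<in>{0..<Suc T}. ?p t)"
    unfolding sum_distrib_left lessThan_atLeast0 by (intro sum.cong) (auto simp: field_simps)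
  finally have total: "real k * real (k + 6 + 2) * \<alpha> \<le> (\<Sum>t\<in>{0..<Suc T}. ?p t)"
    using heavy by (simp add: add.commute)
  have "(\<alpha> / 2) ^ k \<le> measure_pmf.prob (unions ?F [0..<Suc T])
      {u. contains_ascending f k (set u \<inter> (\<Union>t\<in>{0..<Suc T}. ?D t))}"
  proof (rule prob_growing_chain[where p = ?p and d = "k + 6" and \<alpha> = \<alpha>])
    fix t assume "t < Suc T"
    have D: "?D t \<subseteq> window n l t"
      using right_around[of _ l t] right_range n unfolding window_def around_def
      by (fastforce simp: le_diff_conv)
    have win: "window n l t \<noteq> {}" "0 < card (window n l t)"
      using window_props(1)[OF l', of t] window_props(2)[of n l t] by (auto simp: card_gt_0_iff)
    have "?p t \<le> 1 * real (card (?D t)) / real (card (window n l t))"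
    proof -
      have "real (card (window n l t)) \<le> 3 * 2 ^ t"
        using of_nat_mono[OF card_window_le[of n l t], where 'a = real] by simp
      then show ?thesis unfolding card_right_around
        using win(2) by (intro frac_le) auto
    qed
    also have "\<dots> \<le> measure_pmf.prob (?F t) {u. set u \<inter> ?D t \<noteq> {}}"
    proof (rule sample_ge[OF window_props(2) win(1) D])
      fix y assume "y \<in> ?D t"
      have "AE u in search n T (k div 2) y. u \<in> {u. set u \<inter> ?D t \<noteq> {}}"
        unfolding AE_measure_pmf_iff using search_mem[of "k div 2"] k \<open>y \<in> ?D t\<close> by fastforce
      then show "1 \<le> measure_pmf.prob (search n T (k div 2) y) {u. set u \<inter> ?D t \<noteq> {}}"
        using measure_pmf.prob_eq_1[of "{u. set u \<inter> ?D t \<noteq> {}}" "search n T (k div 2) y"] by simp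
    qed
    finally show "0 \<le> ?p t \<and> ?p t \<le> \<alpha> \<and> ?p t \<le> measure_pmf.prob (?F t) {u. set u \<inter> ?D t \<noteq> {}}"
      using small[of t] by (simp add: field_simps)
  next
    fix t t' x y assume "t + (k + 6) \<le> t'" "x \<in> ?D t" "y \<in> ?D t'"
    then show "x < y \<and> f x < f y" using growth by blast
  qed (use \<alpha> total in auto)
  also have "\<dots> \<le> measure_pmf.prob (unions ?F [0..<Suc T])
      {u. contains_ascending f k (set u \<inter> \<Union>(set ` X))}"
  proof (rule measure_pmf.finite_measure_mono)
    have "(\<Union>t\<in>{0..<Suc T}. ?D t) \<subseteq> \<Union>(set ` X)"
      using right_mem in_set_dropD unfolding around_def by fast
    then show "{u. contains_ascending f k (set u \<inter> (\<Union>t\<in>{0..<Suc T}. ?D t))} \<subseteq>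
        {u. contains_ascending f k (set u \<inter> \<Union>(set ` X))}"
      by (auto elim!: contains_ascending_mono)
  qed simp
  also have "\<dots> \<le> success f n T k (\<Union>(set ` X)) l"
    unfolding search_unfold[OF k]
    by (rule prob_join_right[OF mono_contains])
  finally show ?thesis .
qed

text \<open>The tuples at level t are cut at their median, and the pieces are sought within radius
  (k + 1) 2 ^ t of l. In \<open>big\<close>, the factor 2 ^ (k + 2) is 2 ^ (k + 1) for the length of
  this interval times 2 for the median, and 3 is for the passage to a searched window. The
  conclusion has the form of the density hypothesis of \<open>interval_covering\<close>.\<close>

lemma splitting_point:
  assumes n: "n \<le> 2 ^ T" "1 \<le> a" "b \<le> n"
    and find: "\<And>m. 0 < m \<Longrightarrow> m < k \<Longrightarrow> findable m \<epsilon> \<delta>" and \<delta>: "0 \<le> \<delta>" and \<epsilon>: "0 < \<epsilon>"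
    and big: "3 * (\<epsilon> * 2 ^ (k + 2)) * 2 ^ t \<le> real (card (around l t))"
  shows "\<delta> / (2 * real (k + 1)) * real ((k + 1) * 2 ^ t) \<le>
    real (card ({x\<in>{a..b}. \<delta> ^ 3 \<le> success f n T k (\<Union>(set ` X)) x}
      \<inter> {l - (k + 1) * 2 ^ t..l + (k + 1) * 2 ^ t}))"
proof -
  define r where "r = (k + 1) * 2 ^ t"
  define a' where "a' = max a (l - r)"
  define b' where "b' = min b (l + r)"
  let ?S = "\<Union>(set ` X)"
  have I: "{a..b} \<inter> {l - r..l + r} = {a'..b'}" unfolding a'_def b'_def by auto
  have "0 < 3 * (\<epsilon> * 2 ^ (k + 2)) * 2 ^ t" using \<epsilon> by simp
  then have "0 < card (around l t)" using big by linarith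
  then have ne: "around l t \<noteq> {}" by auto
  then obtain \<tau> where \<tau>: "\<tau> \<in> around l t" by blast
  have "(1::nat) \<le> k + 1" by simp
  then have "2 ^ t \<le> r" unfolding r_def using mult_le_mono1[of 1 "k + 1" "2 ^ t"] by simp
  from card_window[OF \<tau> this] have cI: "2 ^ t \<le> 2 * card {a'..b'}" unfolding I .
  then have "0 < card {a'..b'}" by (metis mult_0_right not_gr_zero not_le zero_less_numeral zero_less_power)
  then have ab: "a' \<le> b'" by (simp add: Suc_le_eq)
  have "k + 1 \<le> 2 ^ k" by (metis Suc_eq_plus1 Suc_leI less_exp)
  then have "(k + 1) * 2 ^ t \<le> 2 ^ k * 2 ^ t" by (rule mult_le_mono1)
  then have "2 * r \<le> 2 ^ (t + k + 1)" unfolding r_def by (simp add: power_add mult.commute)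
  moreover have "b' - a' \<le> 2 * r" unfolding a'_def b'_def by auto
  ultimately have len: "b' - a' \<le> 2 ^ (t + k + 1)" by linarith
  have sub: "?S \<subseteq> {a..b}" using tuple by auto
  obtain S\<^sub>1 S\<^sub>2 where S: "S\<^sub>1 \<subseteq> ?S \<inter> {l - r..l + r}" "S\<^sub>2 \<subseteq> ?S \<inter> {l - r..l + r}"
      "hitting_at_least f c S\<^sub>1 (real (card (around l t)) / 2)"
      "hitting_at_least f (k - c) S\<^sub>2 (real (card (around l t)) / 2)"
      and less: "\<And>x y. x \<in> S\<^sub>1 \<Longrightarrow> y \<in> S\<^sub>2 \<Longrightarrow> x < y \<and> f x < f y"
    using median_split[OF order_refl ne] unfolding r_def by metis
  have SI: "S\<^sub>1 \<subseteq> {a'..b'}" "S\<^sub>2 \<subseteq> {a'..b'}"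
    using S(1,2) sub I by blast+
  have comb: "contains_ascending f k (A \<inter> ?S)"
    if "contains_ascending f c (A \<inter> S\<^sub>1)" "contains_ascending f (k - c) (A \<inter> S\<^sub>2)" for A
    using contains_ascending_append[OF that, of ?S] less S(1,2) c by auto
  have M: "\<epsilon> * (3 * 2 ^ (t + k + 1)) \<le> real (card (around l t)) / 2"
    using big by (simp add: power_add algebra_simps)
  have n': "1 \<le> a'" "b' \<le> n" using n unfolding a'_def b'_def by auto
  have fc: "findable c \<epsilon> \<delta>" "findable (k - c) \<epsilon> \<delta>" using find[of c] find[of "k - c"] c by auto
  have "\<delta> * real (card {a'..b'}) \<le> real (card {x\<in>{a'..b'}. \<delta> ^ 3 \<le> success f n T k ?S x})"
  \<comment> \<open>Whichever piece has length at most k div 2 is the one sought at a guessed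
    scale.\<close>
  proof (cases "k - c \<le> k div 2")
    case True
    show ?thesis
      by (rule heavy_light[OF fc(1) fc(2) \<delta> _ _ _ _ True n(1) n'(1) ab n'(2) len M SI(1) S(3) SI(2) S(4)])
        (use c \<epsilon> comb in auto)
  next
    case False
    then have le: "c \<le> k div 2" by linarith
    show ?thesis
      by (rule heavy_light[OF fc(2) fc(1) \<delta> _ _ _ _ le n(1) n'(1) ab n'(2) len M SI(2) S(4) SI(1) S(3)])
        (use c \<epsilon> comb in auto)
  qed
  also have "{x\<in>{a'..b'}. \<delta> ^ 3 \<le> success f n T k ?S x} =
      {x\<in>{a..b}. \<delta> ^ 3 \<le> success f n T k ?S x} \<inter> {l - r..l + r}"
    using I by auto
  finally have "\<delta> * real (card {a'..b'}) \<le>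
    real (card ({x\<in>{a..b}. \<delta> ^ 3 \<le> success f n T k ?S x} \<inter> {l - r..l + r}))" .
  \<comment> \<open>Cutting the window down to [a, b] leaves at least 2 ^ t / 2 points; compared
    with the radius (k + 1) 2 ^ t this gives the denominator 2 (k + 1).\<close>
  moreover have "\<delta> / (2 * real (k + 1)) * real ((k + 1) * 2 ^ t) = \<delta> * (2 ^ t / 2)"
    by (simp add: field_simps)
  moreover have "real (2 ^ t) \<le> real (2 * card {a'..b'})" using cI by (rule of_nat_mono)
  then have "\<delta> * (2 ^ t / 2) \<le> \<delta> * real (card {a'..b'})" using \<delta> by (intro mult_left_mono) auto
  ultimately show ?thesis unfolding r_def by linarith
qed

end

text \<open>By maximality the points of a greedy family hit every tuple, so h \<le> k card X. By
  pigeonhole, some position of the largest gap keeps at least a fraction 1 / k of the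
  family.\<close>

lemma exists_gap_family:
  assumes k: "2 \<le> k" and S: "S \<subseteq> {a..b}" and hit: "hitting_at_least f k S h"
  obtains c X where "gap_family f k c a b X" "\<Union>(set ` X) \<subseteq> S" "h \<le> real k ^ 2 * real (card X)"
proof -
  have "finite S" using S finite_subset by blast
  have kpos: "0 < k" using k by simp
  obtain X where fin: "finite X"
      and X: "\<forall>\<tau>\<in>X. length \<tau> = k \<and> set \<tau> \<subseteq> S \<and> ascending f \<tau>"
      and disj: "\<forall>\<tau>\<in>X. \<forall>\<sigma>\<in>X. \<tau> \<noteq> \<sigma> \<longrightarrow> set \<tau> \<inter> set \<sigma> = {}"
      and greedy: "\<forall>\<tau>\<in>X. \<forall>\<sigma>\<in>X. \<forall>c. hd \<tau> < hd \<sigma> \<longrightarrow> 0 < c \<longrightarrow> c < k \<longrightarrow>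
          \<tau> ! (c - 1) < \<sigma> ! c \<longrightarrow> \<sigma> ! c < \<tau> ! c \<longrightarrow> f (\<sigma> ! c) \<le> f (\<tau> ! (c - 1))"
      and maxi: "\<not> contains_ascending f k (S - \<Union>(set ` X))"
    using greedy_family[OF \<open>finite S\<close> kpos, of f] by (elim exE conjE) (rule that)
  have "card (\<Union>(set ` X)) \<le> (\<Sum>\<tau>\<in>X. card (set \<tau>))"
    using fin by (rule card_UN_le)
  also have "\<dots> \<le> (\<Sum>\<tau>\<in>X. k)" using X by (intro sum_mono) (metis card_length)
  finally have "card (\<Union>(set ` X)) \<le> card X * k" by simp
  then have "real (card (\<Union>(set ` X))) \<le> real (card X * k)" by (rule of_nat_mono)
  moreover have "h \<le> real (card (\<Union>(set ` X)))"
    using hit maxi fin unfolding hitting_at_least_def by (meson List.finite_set finite_UN not_less)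
  ultimately have h: "h \<le> real (card X) * real k" by simp
  define Y where "Y c = {\<tau>\<in>X. \<forall>i. Suc i < k \<longrightarrow> \<tau> ! Suc i - \<tau> ! i \<le> \<tau> ! c - \<tau> ! (c - 1)}" for c
  have "X \<subseteq> (\<Union>c\<in>{1..<k}. Y c)"
  proof
    fix \<tau> assume "\<tau> \<in> X"
    let ?g = "\<lambda>i. \<tau> ! Suc i - \<tau> ! i"
    have "Max (?g ` {..<k - 1}) \<in> ?g ` {..<k - 1}"
      using k by (intro Max_in) (auto simp: lessThan_empty_iff)
    then obtain i where i: "i < k - 1" "?g i = Max (?g ` {..<k - 1})" by auto
    have "?g j \<le> ?g i" if "Suc j < k" for j
      unfolding i(2) using that by (intro Max_ge) auto
    then have "\<tau> \<in> Y (Suc i)" using \<open>\<tau> \<in> X\<close> unfolding Y_def by simp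
    then show "\<tau> \<in> (\<Union>c\<in>{1..<k}. Y c)" using i(1) by (intro UN_I[of "Suc i"]) auto
  qed
  then have "card X \<le> card (\<Union>c\<in>{1..<k}. Y c)"
    using fin unfolding Y_def by (intro card_mono) auto
  also have "\<dots> \<le> (\<Sum>c\<in>{1..<k}. card (Y c))" by (rule card_UN_le) simp
  finally have sum: "card X \<le> (\<Sum>c\<in>{1..<k}. card (Y c))" .
  have "\<exists>c\<in>{1..<k}. card X \<le> k * card (Y c)"
  proof (rule ccontr)
    assume "\<not> ?thesis"
    then have lt: "k * card (Y c) < card X" if "c \<in> {1..<k}" for c using that by (meson not_le)
    have "k * card X \<le> (\<Sum>c\<in>{1..<k}. k * card (Y c))"
      using mult_le_mono2[OF sum, of k] by (simp add: sum_distrib_left)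
    also have "\<dots> \<le> (\<Sum>c\<in>{1..<k}. card X)"
      using lt by (intro sum_mono) (simp add: less_imp_le)
    also have "\<dots> = (k - 1) * card X" by simp
    finally have "card X = 0" using k by (cases k) auto
    then show False using lt[of 1] k by simp
  qed
  then obtain c where c: "c \<in> {1..<k}" "card X \<le> k * card (Y c)" by blast
  show thesis
  proof (rule that[of c "Y c"])
    show "gap_family f k c a b (Y c)"
    proof
      show "finite (Y c)" using fin unfolding Y_def by simp
      show "0 < c" "c < k" using c(1) by auto
      fix \<tau> \<sigma> assume "\<tau> \<in> Y c" "\<sigma> \<in> Y c"
      then have "\<tau> \<in> X" "\<sigma> \<in> X" unfolding Y_def by auto
      then show "length \<tau> = k \<and> set \<tau> \<subseteq> {a..b} \<and> ascending f \<tau>"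
          "\<tau> \<noteq> \<sigma> \<Longrightarrow> set \<tau> \<inter> set \<sigma> = {}"
          "hd \<tau> < hd \<sigma> \<Longrightarrow> \<tau> ! (c - 1) < \<sigma> ! c \<Longrightarrow> \<sigma> ! c < \<tau> ! c \<Longrightarrow> f (\<sigma> ! c) \<le> f (\<tau> ! (c - 1))"
        using X S disj greedy c(1) by auto
    qed (auto simp: Y_def)
    show "\<Union>(set ` Y c) \<subseteq> S" using X unfolding Y_def by auto
    have "real (card X) \<le> real (k * card (Y c))" using c(2) by (rule of_nat_mono)
    then have "real (card X) * real k \<le> real (k * card (Y c)) * real k"
      by (rule mult_right_mono) simp
    then show "h \<le> real k ^ 2 * real (card (Y c))"
      using h by (simp add: power2_eq_square mult_ac)
  qed
qed

section \<open>The induction on the pattern length\<close>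

text \<open>The value of \<alpha> makes 6 k (k + 8) \<alpha> equal to \<epsilon> / (4 k ^ 2), a
  guaranteed weight of the heavy points. Shorter lengths are called at \<alpha> / 2 ^ (k + 2) to
  match \<open>splitting_point\<close>. The constant 1280 is 128 * 2 * 5: the share of the
  prevailing kind of heavy points, the density in a window, and the covering. A product of the
  losses replaces their minimum, so that a monomial \<delta> in \<epsilon> yields a monomial
  again.\<close>

lemma findable_step:
  fixes \<epsilon> \<delta> :: real
  defines "\<alpha> k \<equiv> \<epsilon> / (24 * real k ^ 2 * (real k * real (k + 8)))"
  assumes k: "2 \<le> k" and \<epsilon>: "0 < \<epsilon>" "\<epsilon> \<le> 1" and \<delta>: "0 \<le> \<delta>" "\<delta> \<le> 1"
    and find: "\<And>m. 0 < m \<Longrightarrow> m < k \<Longrightarrow> findable m (\<alpha> k / 2 ^ (k + 2)) \<delta>"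
  shows "findable k \<epsilon> (\<delta> ^ 3 * (\<epsilon> / (1280 * real k ^ 2 * real (k + 1))) * (\<alpha> k / 2) ^ k)"
proof -
  define \<alpha>' where "\<alpha>' = \<alpha> k"
  define q where "q = \<epsilon> / (1280 * real k ^ 2 * real (k + 1))"
  define \<eta> where "\<eta> = \<delta> ^ 3 * q * (\<alpha>' / 2) ^ k"
  have k1: "1 \<le> real k" "1 \<le> real k ^ 2" "1 \<le> real (k + 8)" "1 \<le> real (k + 1)"
    using k one_le_power[of "real k" 2] by auto
  have prod_ge1: "1 \<le> x * y" if "1 \<le> x" "1 \<le> y" for x y :: real
    using mult_mono[of 1 x 1 y] that by simp
  have frac: "0 < \<epsilon> / x \<and> \<epsilon> / x \<le> 1" if "1 \<le> x" for x
    using that \<epsilon> by (simp add: divide_le_eq)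
  have "1 \<le> 24 * real k ^ 2 * (real k * real (k + 8))"
    by (intro prod_ge1 k1) simp
  then have \<alpha>: "0 < \<alpha>'" "\<alpha>' \<le> 1"
    unfolding \<alpha>'_def \<alpha>_def using frac by blast+
  have "1 \<le> 1280 * real k ^ 2 * real (k + 1)"
    by (intro prod_ge1 k1) simp
  then have q: "0 < q" "q \<le> 1"
    unfolding q_def using frac by blast+
  have A: "0 \<le> (\<alpha>' / 2) ^ k" "(\<alpha>' / 2) ^ k \<le> 1"
    using \<alpha> by (auto intro!: power_le_one)
  have d3: "0 \<le> \<delta> ^ 3" "\<delta> ^ 3 \<le> 1" "\<delta> ^ 3 \<le> \<delta>"
    using \<delta> power_decreasing[of 1 3 \<delta>] by (auto intro!: power_le_one)
  \<comment> \<open>\<eta> must lie below every quantity it replaces: the fractions q and \<delta> q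
    of starting points, and the success probabilities \<delta> ^ 3 and (\<alpha>' / 2) ^ k.\<close>
  have "\<eta> \<le> (\<delta> ^ 3 * q) * 1" unfolding \<eta>_def using A d3 q by (intro mult_left_mono) auto
  then have \<eta>\<^sub>1: "\<eta> \<le> \<delta> ^ 3 * q" by simp
  have "\<delta> ^ 3 * q \<le> \<delta> ^ 3 * 1" using q d3 by (intro mult_left_mono) auto
  then have \<eta>\<^sub>2: "\<eta> \<le> \<delta> ^ 3" using \<eta>\<^sub>1 by simp
  have "\<delta> ^ 3 * q \<le> \<delta> * q" using q d3 by (intro mult_right_mono) auto
  then have \<eta>\<^sub>3: "\<eta> \<le> \<delta> * q" using \<eta>\<^sub>1 by simp
  have "\<delta> * q \<le> 1 * q" using q \<delta> by (intro mult_right_mono) auto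
  then have \<eta>\<^sub>4: "\<eta> \<le> q" using \<eta>\<^sub>3 by simp
  have "\<delta> ^ 3 * q \<le> 1 * 1" using d3 q by (intro mult_mono) auto
  then have "(\<delta> ^ 3 * q) * (\<alpha>' / 2) ^ k \<le> 1 * (\<alpha>' / 2) ^ k" using A by (intro mult_right_mono) auto
  then have \<eta>\<^sub>5: "\<eta> \<le> (\<alpha>' / 2) ^ k" unfolding \<eta>_def by simp
  have "findable k \<epsilon> \<eta>"
    unfolding findable_def
  proof (intro allI impI)
    fix f :: "nat \<Rightarrow> real" and n T a b :: nat and S
    assume n: "n \<le> 2 ^ T" "1 \<le> a" "a \<le> b" "b \<le> n" and S: "S \<subseteq> {a..b}"
      and hit: "hitting_at_least f k S (\<epsilon> * real (card {a..b}))"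
    define J where "J = real (card {a..b})"
    have J: "0 < J" unfolding J_def using n(3) by simp
    obtain c X where fam: "gap_family f k c a b X" and XS: "\<Union>(set ` X) \<subseteq> S"
      and N: "\<epsilon> * J \<le> real k ^ 2 * real (card X)"
      using exists_gap_family[OF k S hit] unfolding J_def by metis
    interpret gap_family f k c a b X by (rule fam)
    define N where "N = real (card X)"
    let ?S = "\<Union>(set ` X)"
    let ?H = "{x\<in>{a..b}. \<eta> \<le> success f n T k S x}"
    have lift: "success f n T k ?S x \<le> success f n T k S x" for x
      using XS by (intro measure_pmf.finite_measure_mono) (auto elim!: contains_ascending_mono)
    define G where "G = {l\<in>{a..b}. N / (4 * J) \<le> weight l}"
    define GA where "GA = {l\<in>G. \<forall>t. real (card (around l t)) \<le> 3 * \<alpha>' * 2 ^ t}"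
    define GB where "GB = G - GA"
    have finG: "finite G" unfolding G_def by simp
    have G: "N / 64 \<le> real (card G)"
      using many_heavy_points[OF n(3)] unfolding G_def N_def J_def .
    have "card G = card (GA \<union> GB)" unfolding GB_def GA_def by (rule arg_cong[of _ _ card]) auto
    then have "card G \<le> card GA + card GB" using card_Un_le[of GA GB] by simp
    then have two: "N / 128 \<le> real (card GA) \<or> N / 128 \<le> real (card GB)" using G by linarith
    have qJ: "q * J \<le> N / (1280 * real (k + 1))"
    proof -
      have "q * J = (\<epsilon> * J) / (real k ^ 2 * (1280 * real (k + 1)))"
        unfolding q_def by (simp add: mult_ac)
      also have "\<dots> \<le> (real k ^ 2 * N) / (real k ^ 2 * (1280 * real (k + 1)))"
        using N unfolding N_def by (intro divide_right_mono) auto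
      also have "\<dots> = N / (1280 * real (k + 1))" using k by simp
      finally show ?thesis .
    qed
    have N0: "0 \<le> N" unfolding N_def by simp
    show "\<eta> * J \<le> real (card ?H)"
      using two
    proof
      assume GA: "N / 128 \<le> real (card GA)"
      have "GA \<subseteq> ?H"
      proof
        fix l assume "l \<in> GA"
        then have l: "l \<in> {a..b}" "N / (4 * J) \<le> weight l"
          and small: "\<And>t. real (card (around l t)) \<le> 3 * \<alpha>' * 2 ^ t"
          unfolding GA_def G_def by auto
        have "6 * (real k * real (k + 8) * \<alpha>') = \<epsilon> / (4 * real k ^ 2)"
        proof -
          have "6 * (x * (\<epsilon> / (24 * y * x))) = \<epsilon> / (4 * y)" if "x \<noteq> 0" for x y :: real
            using that by simp
          from this[of "real k * real (k + 8)" "real k ^ 2"] show ?thesis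
            unfolding \<alpha>'_def \<alpha>_def using k by simp
        qed
        also have "\<dots> \<le> N / (4 * J)"
          using N J k unfolding N_def by (simp add: field_simps)
        also note l(2)
        finally have "(\<alpha>' / 2) ^ k \<le> success f n T k ?S l"
          using growing_point[OF n(1,2,4) l(1) \<alpha> small] by blast
        then show "l \<in> ?H" using \<eta>\<^sub>5 lift[of l] l(1) by auto
      qed
      then have "card GA \<le> card ?H" by (intro card_mono) auto
      moreover have "\<eta> * J \<le> q * J" using \<eta>\<^sub>4 J by (intro mult_right_mono) auto
      moreover have "N / (1280 * real (k + 1)) \<le> N / 128"
        using N0 k by (intro divide_left_mono) auto
      ultimately show ?thesis using GA qJ by linarith
    next
      assume GB: "N / 128 \<le> real (card GB)"
      have "\<exists>t. 3 * \<alpha>' * 2 ^ t \<le> real (card (around l t))" if "l \<in> GB" for l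
        using that unfolding GB_def GA_def by (auto simp: not_le intro: less_imp_le)
      then obtain t where t: "\<And>l. l \<in> GB \<Longrightarrow> 3 * \<alpha>' * 2 ^ t l \<le> real (card (around l (t l)))"
        by metis
      \<comment> \<open>Points of \<open>GB\<close> need not be good starting points. Each only
        guarantees a density of good ones nearby, and these neighbourhoods overlap.\<close>
      have "\<delta> / (2 * real (k + 1)) * real (card GB) \<le> 5 * real (card ?H)"
      proof (rule interval_covering[where \<rho> = "\<lambda>l. (k + 1) * 2 ^ t l"])
        fix l assume l: "l \<in> GB"
        have \<epsilon>': "0 < \<alpha>' / 2 ^ (k + 2)" using \<alpha> by simp
        have big: "3 * (\<alpha>' / 2 ^ (k + 2) * 2 ^ (k + 2)) * 2 ^ t l \<le> real (card (around l (t l)))"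
          using t[OF l] by simp
        have "\<delta> / (2 * real (k + 1)) * real ((k + 1) * 2 ^ t l) \<le>
            real (card ({x\<in>{a..b}. \<delta> ^ 3 \<le> success f n T k ?S x} \<inter> {l - (k + 1) * 2 ^ t l..l + (k + 1) * 2 ^ t l}))"
          by (rule splitting_point[OF n(1,2,4) find[folded \<alpha>'_def] \<delta>(1) \<epsilon>' big])
        also have "\<dots> \<le> real (card (?H \<inter> {l - (k + 1) * 2 ^ t l..l + (k + 1) * 2 ^ t l}))"
          using \<eta>\<^sub>2 lift by (intro of_nat_mono card_mono) (auto intro: order_trans)
        finally show "\<delta> / (2 * real (k + 1)) * real ((k + 1) * 2 ^ t l) \<le>
            real (card (?H \<inter> {l - (k + 1) * 2 ^ t l..l + (k + 1) * 2 ^ t l}))" .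
      qed (use \<delta> finG in \<open>auto simp: GB_def Suc_le_eq\<close>)
      moreover have "\<delta> / (2 * real (k + 1)) * (N / 128) \<le> \<delta> / (2 * real (k + 1)) * real (card GB)"
        using GB \<delta> by (intro mult_left_mono) auto
      moreover have "\<eta> * J \<le> \<delta> * (q * J)" using mult_right_mono[OF \<eta>\<^sub>3, of J] J by (simp add: mult.assoc)
      moreover have "\<delta> * (q * J) \<le> \<delta> * (N / (1280 * real (k + 1)))"
        using qJ \<delta> by (intro mult_left_mono) auto
      moreover have "\<delta> / (2 * real (k + 1)) * (N / 128) = 5 * (\<delta> * (N / (1280 * real (k + 1))))"
        by (simp add: field_simps)
      ultimately show ?thesis by linarith
    qed
  qed
  then show ?thesis unfolding \<eta>_def \<alpha>'_def q_def .
qed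

text \<open>One pair c, e serves all lengths up to k, so every shorter length can be called at the
  same shrunken parameter \<kappa> \<epsilon>. In the new exponent 3 e + 1 + k, the terms come from
  \<delta> ^ 3, from the fraction of starting points and from (\<alpha> / 2) ^ k.\<close>

lemma findable_polynomially:
  "\<exists>c e. 0 < c \<and> c \<le> 1 \<and> (\<forall>m\<in>{1..k}. \<forall>\<epsilon>. 0 < \<epsilon> \<longrightarrow> \<epsilon> \<le> 1 \<longrightarrow> findable m \<epsilon> (c * \<epsilon> ^ e))"
proof (induction k)
  case 0
  show ?case by (intro exI[of _ 1] exI[of _ 0]) auto
next
  case (Suc k')
  define k where "k = Suc k'"
  obtain c e where c: "0 < c" "c \<le> 1"
    and IH: "\<And>m \<epsilon>. m \<in> {1..k'} \<Longrightarrow> 0 < \<epsilon> \<Longrightarrow> \<epsilon> \<le> 1 \<Longrightarrow> findable m \<epsilon> (c * \<epsilon> ^ e)"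
    using Suc.IH by blast
  show ?case
  proof (cases "k' = 0")
    case True
    have "findable m \<epsilon> (1 * \<epsilon> ^ 1)" if "m \<in> {1..Suc k'}" "\<epsilon> \<le> 1" for m \<epsilon>
      using findable_one that True by (cases m) auto
    then show ?thesis by (intro exI[of _ 1] exI[of _ 1]) auto
  next
    case False
    then have k: "2 \<le> k" unfolding k_def by simp
    define D where "D = 24 * real k ^ 2 * (real k * real (k + 8))"
    define \<kappa> where "\<kappa> = 1 / (D * 2 ^ (k + 2))"
    define E where "E = 1280 * real k ^ 2 * real (k + 1)"
    define c' where "c' = (c * \<kappa> ^ e) ^ 3 / E / (2 * D) ^ k"
    define e' where "e' = 3 * e + 1 + k"
    have prod_ge1: "1 \<le> x * y" if "1 \<le> x" "1 \<le> y" for x y :: real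
      using mult_mono[of 1 x 1 y] that by simp
    have k1: "1 \<le> real k" "1 \<le> real k ^ 2" "1 \<le> real (k + 8)" "1 \<le> real (k + 1)"
      using k one_le_power[of "real k" 2] by auto
    have D: "1 \<le> D" unfolding D_def by (intro prod_ge1 k1) simp
    have E: "1 \<le> E" unfolding E_def by (intro prod_ge1 k1) simp
    have "1 \<le> D * 2 ^ (k + 2)" by (intro prod_ge1 D one_le_power) simp
    then have "0 < D * 2 ^ (k + 2)" "1 \<le> D * 2 ^ (k + 2)" by linarith+
    then have \<kappa>: "0 < \<kappa>" "\<kappa> \<le> 1"
      unfolding \<kappa>_def by (simp_all only: zero_less_divide_1_iff divide_le_eq_1_pos)
    have c'pos: "0 < c'" unfolding c'_def using c \<kappa> D E by simp
    have new: "findable k \<epsilon> (c' * \<epsilon> ^ e')" if \<epsilon>: "0 < \<epsilon>" "\<epsilon> \<le> 1" for \<epsilon>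
    proof -
      have \<kappa>\<epsilon>: "0 < \<kappa> * \<epsilon>" "\<kappa> * \<epsilon> \<le> 1" using \<kappa> \<epsilon> by (auto intro: mult_le_one)
      have "findable k \<epsilon> ((c * (\<kappa> * \<epsilon>) ^ e) ^ 3 * (\<epsilon> / (1280 * real k ^ 2 * real (k + 1)))
          * (\<epsilon> / (24 * real k ^ 2 * (real k * real (k + 8))) / 2) ^ k)"
      proof (rule findable_step[OF k \<epsilon>])
        show "0 \<le> c * (\<kappa> * \<epsilon>) ^ e" using c \<kappa>\<epsilon> by simp
        show "c * (\<kappa> * \<epsilon>) ^ e \<le> 1" using c \<kappa>\<epsilon> less_imp_le[OF \<kappa>\<epsilon>(1)]
          by (intro mult_le_one power_le_one[OF less_imp_le[OF \<kappa>\<epsilon>(1)] \<kappa>\<epsilon>(2)]) (auto intro: zero_le_power)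
        fix m assume "0 < m" "m < k"
        then have "findable m (\<kappa> * \<epsilon>) (c * (\<kappa> * \<epsilon>) ^ e)"
          using IH \<kappa>\<epsilon> unfolding k_def by auto
        then show "findable m (\<epsilon> / (24 * real k ^ 2 * (real k * real (k + 8))) / 2 ^ (k + 2)) (c * (\<kappa> * \<epsilon>) ^ e)"
          unfolding \<kappa>_def D_def by simp
      qed
      also have "(c * (\<kappa> * \<epsilon>) ^ e) ^ 3 * (\<epsilon> / (1280 * real k ^ 2 * real (k + 1)))
          * (\<epsilon> / (24 * real k ^ 2 * (real k * real (k + 8))) / 2) ^ k = c' * \<epsilon> ^ e'"
        unfolding D_def[symmetric] E_def[symmetric] c'_def e'_def
        by (simp add: power_mult_distrib power_divide power_add power_mult[symmetric] mult_ac)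
      finally show ?thesis .
    qed
    define c'' where "c'' = min c c'"
    have pos: "0 < c''" "c'' \<le> 1" "c'' \<le> c" "c'' \<le> c'" unfolding c''_def using c c'pos by auto
    have "findable m \<epsilon> (c'' * \<epsilon> ^ e')" if m: "m \<in> {1..Suc k'}" and \<epsilon>: "0 < \<epsilon>" "\<epsilon> \<le> 1" for m \<epsilon>
    proof (cases "m = k")
      case True
      have "c'' * \<epsilon> ^ e' \<le> c' * \<epsilon> ^ e'" using pos \<epsilon> by (intro mult_right_mono) auto
      then show ?thesis using findable_mono[OF new[OF \<epsilon>]] True by simp
    next
      case False
      have "\<epsilon> ^ e' \<le> \<epsilon> ^ e" using \<epsilon> unfolding e'_def by (intro power_decreasing) auto
      then have "c'' * \<epsilon> ^ e' \<le> c * \<epsilon> ^ e" using pos \<epsilon> c by (intro mult_mono) auto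
      then show ?thesis using findable_mono[OF IH[of m, OF _ \<epsilon>]] m False unfolding k_def by simp
    qed
    then show ?thesis using pos(1,2) by blast
  qed
qed

lemma search_cost_bound:
  "\<exists>C. 0 \<le> C \<and> (\<forall>T. real (search_cost T k) \<le> C * real (Suc T) ^ floor_log k)"
proof (induction k rule: less_induct)
  case (less k)
  show ?case
  proof (cases "k \<le> 1")
    case True
    then have "search_cost T k \<le> 1" for T by (cases k) auto
    then show ?thesis using True by (intro exI[of _ 1]) (auto simp: le_Suc_eq)
  next
    case False
    then have k: "2 \<le> k" by simp
    obtain k' where k': "k = Suc (Suc k')" using k by (metis Suc_le_D numeral_2_eq_2 Suc_le_mono)
    obtain C where C: "0 \<le> C" "\<And>T. real (search_cost T (k - 1)) \<le> C * real (Suc T) ^ floor_log (k - 1)"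
      using less[of "k - 1"] k by auto
    obtain C' where C': "0 \<le> C'" "\<And>T. real (search_cost T (k div 2)) \<le> C' * real (Suc T) ^ floor_log (k div 2)"
      using less[of "k div 2"] k by auto
    have "real (search_cost T k) \<le> (C + C') * real (Suc T) ^ floor_log k" for T
    proof -
      have "floor_log (k - 1) \<le> floor_log k" by (rule floor_log_le_iff) simp
      then have "C * real (Suc T) ^ floor_log (k - 1) \<le> C * real (Suc T) ^ floor_log k"
        using C(1) by (intro mult_left_mono power_increasing) auto
      \<comment> \<open>The number of scales is absorbed because \<open>floor_log k\<close> is one
        more than \<open>floor_log (k div 2)\<close>.\<close>
      moreover have "real (Suc T) * (C' * real (Suc T) ^ floor_log (k div 2)) = C' * real (Suc T) ^ floor_log k"
        unfolding floor_log_rec[OF k] power_Suc by (simp only: mult_ac)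
      moreover have "real (Suc T) * real (search_cost T (k div 2)) \<le>
          real (Suc T) * (C' * real (Suc T) ^ floor_log (k div 2))"
        using C'(2) by (rule mult_left_mono) simp
      moreover have "real (search_cost T k) = real (search_cost T (k - 1)) + real (Suc T) * real (search_cost T (k div 2))"
        unfolding k' by (simp add: distrib_right)
      ultimately show ?thesis using C(2)[of T] by (simp add: distrib_right)
    qed
    then show ?thesis using C(1) C'(1) by (intro exI[of _ "C + C'"]) auto
  qed
qed

section \<open>Distance from pattern-freeness and degenerate parameters\<close>

text \<open>A function that is altered only on \<^term>\<open>Z\<close> can be made pattern free by copying, at every
  point of \<^term>\<open>Z\<close>, the value at the closest unaltered point to the left (or the first one).\<close>

lemma far_from_free_hitting:
  assumes far: "far_from_free n k \<epsilon> f" and n: "1 \<le> n" and "\<epsilon> \<le> 1"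
  shows "hitting_at_least f k {1..n} (\<epsilon> * real n)"
  unfolding hitting_at_least_def
proof (intro allI impI, rule ccontr)
  fix Z assume Z: "finite Z" "real (card Z) < \<epsilon> * real n"
    and free: "\<not> contains_ascending f k ({1..n} - Z)"
  define R where "R = {1..n} - Z"
  have "finite R" unfolding R_def by simp
  \<comment> \<open>For \<epsilon> \<le> 1 some unaltered point remains to copy from.\<close>
  have "\<epsilon> * real n \<le> 1 * real n" using assms(3) by (rule mult_right_mono) simp
  then have "card Z < n" using Z(2) by linarith
  then have "R \<noteq> {}"
    unfolding R_def using card_mono[OF Z(1), of "{1..n}"] by auto
  define L where "L i = {j\<in>R. j \<le> i}" for i
  define pr where "pr i = (if L i = {} then Min R else Max (L i))" for i
  have finL: "finite (L i)" for i unfolding L_def using \<open>finite R\<close> by simp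
  have pr_mem: "pr i \<in> R" for i
    using Max_in[OF finL, of i] Min_in[OF \<open>finite R\<close> \<open>R \<noteq> {}\<close>] unfolding pr_def L_def by auto
  have pr_mono: "pr i \<le> pr j" if "i \<le> j" for i j
  proof -
    have "L i \<subseteq> L j" using that unfolding L_def by auto
    then show ?thesis
      using Max_mono[of "L i" "L j"] finL[of j] Min_le[OF \<open>finite R\<close>, of "Max (L j)"] Max_in[OF finL, of j]
      unfolding pr_def L_def by auto
  qed
  have pr_id: "pr i = i" if "i \<in> R" for i
  proof -
    have "i \<in> L i" using that unfolding L_def by simp
    then show ?thesis unfolding pr_def using finL[of i] by (auto intro!: Max_eqI simp: L_def)
  qed
  have "pattern_free n k (\<lambda>i. f (pr i))"
    unfolding pattern_free_def monotone_subsequence_iff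
  proof safe
    fix xs assume xs: "ascending (\<lambda>i. f (pr i)) xs" "k = length xs"
    \<comment> \<open>Since \<open>pr\<close> is nondecreasing and different values exclude pr x =
      pr y, an ascending tuple of the altered function is carried to one of f inside R.\<close>
    have "pr x < pr y" if "x < y" "f (pr x) < f (pr y)" for x y
      using pr_mono[of x y] that by (metis less_imp_le order_le_imp_less_or_eq order_less_irrefl)
    then have "ascending f (map pr xs)"
      unfolding sorted_wrt_map by (intro sorted_wrt_mono_rel[OF _ xs(1)]) auto
    then have "contains_ascending f k R"
      unfolding contains_ascending_def using xs(2) pr_mem by (intro exI[of _ "map pr xs"]) auto
    then show False using free unfolding R_def by simp
  qed
  then have "\<epsilon> \<le> measure_pmf.prob (pmf_of_set {1..n}) {i. f i \<noteq> f (pr i)}"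
    using far unfolding far_from_free_def by blast
  also have "\<dots> = real (card ({1..n} \<inter> {i. f i \<noteq> f (pr i)})) / real n"
    using n by (subst measure_pmf_of_set) auto
  also have "\<dots> \<le> real (card Z) / real n"
    using pr_id Z(1) unfolding R_def by (intro divide_right_mono of_nat_mono card_mono) force+
  finally show False using Z(2) n by (simp add: field_simps)
qed

text \<open>For k \<ge> 2 a decreasing function is pattern free, and no f can differ from it with
  probability above 1.\<close>

lemma not_far_if_gt_one:
  assumes "2 \<le> k" "1 < \<epsilon>"
  shows "\<not> far_from_free n k \<epsilon> f"
proof
  assume far: "far_from_free n k \<epsilon> f"
  have "pattern_free n k (\<lambda>i. - real i)"
    unfolding pattern_free_def monotone_subsequence_iff
  proof safe
    fix xs :: "nat list" assume xs: "ascending (\<lambda>i. - real i) xs" "k = length xs"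
    then show False
      using sorted_wrt_nth_less[OF xs(1), of 0 1] assms(1) by auto
  qed
  then have "\<epsilon> \<le> measure_pmf.prob (pmf_of_set {1..n}) {i. f i \<noteq> - real i}"
    using far unfolding far_from_free_def by blast
  then show False using assms(2) measure_pmf.prob_le_1 by (metis less_le_not_le order_trans)
qed

lemma contains_ascending_card:
  assumes "contains_ascending f k S" "finite S"
  shows "k \<le> card S"
proof -
  obtain xs where xs: "length xs = k" "set xs \<subseteq> S" "ascending f xs"
    using assms(1) unfolding contains_ascending_def by blast
  have "sorted_wrt (<) xs" by (rule sorted_wrt_mono_rel[OF _ xs(3)]) simp
  then have "distinct xs" by (simp add: strict_sorted_iff)
  then show ?thesis using card_mono[OF assms(2) xs(2)] xs(1) by (simp add: distinct_card)
qed

section \<open>From lists of positions to decision trees\<close>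

primrec query_all :: "nat list \<Rightarrow> (nat \<Rightarrow> real) \<Rightarrow> ((nat \<Rightarrow> real) \<Rightarrow> 'o) \<Rightarrow> 'o query_tree" where
  "query_all [] h out = Output (out h)"
| "query_all (i # u) h out = Query i (\<lambda>y. query_all u (h(i := y)) out)"

lemma queries_query_all: "queries (query_all u h out) f = u"
  by (induction u arbitrary: h) auto

lemma run_query_all: "run (query_all u h out) f = out (\<lambda>i. if i \<in> set u then f i else h i)"
proof (induction u arbitrary: h)
  case (Cons i u)
  have "(\<lambda>j. if j \<in> set u then f j else (h(i := f i)) j) = (\<lambda>j. if j \<in> set (i # u) then f j else h j)"
    by auto
  then show ?case using Cons by simp
qed simp

text \<open>The argument h is the record of answers, not f. Without an ascending k-tuple among the
  queried points the value is arbitrary, and nothing is claimed about such runs.\<close>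

definition report :: "nat \<Rightarrow> nat list \<Rightarrow> (nat \<Rightarrow> real) \<Rightarrow> nat list" where
  "report k u h = (SOME xs. length xs = k \<and> set xs \<subseteq> set u \<and> ascending h xs)"

text \<open>The record agrees with f on the queried points, so the same tuples of queried points are
  ascending for both.\<close>

lemma run_report:
  assumes "contains_ascending f k (set u)" "set u \<subseteq> {1..n}"
  shows "monotone_subsequence n k f (run (query_all u h (report k u)) f)"
proof -
  define g where "g i = (if i \<in> set u then f i else h i)" for i
  have same: "ascending g xs = ascending f xs" if "set xs \<subseteq> set u" for xs
    by (rule iffI; erule sorted_wrt_mono_rel[rotated]) (use that in \<open>auto simp: g_def subset_eq\<close>)
  obtain xs where xs: "length xs = k" "set xs \<subseteq> set u" "ascending f xs"
    using assms(1) unfolding contains_ascending_def by blast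
  define r where "r = report k u g"
  have "length xs = k \<and> set xs \<subseteq> set u \<and> ascending g xs"
    using xs same[OF xs(2)] by simp
  then have "length r = k \<and> set r \<subseteq> set u \<and> ascending g r"
    unfolding r_def report_def by (rule someI)
  then have r: "length r = k" "set r \<subseteq> set u" "ascending g r" by simp_all
  have "run (query_all u h (report k u)) f = r"
    unfolding run_query_all r_def g_def ..
  then show ?thesis
    unfolding monotone_subsequence_iff using r(1,3) same[OF r(2)] subset_trans[OF r(2) assms(2)] by simp
qed

text \<open>One uniform start succeeds with probability p at least the square of \<delta>. The
  number R of independent repetitions makes R p \<ge> 9, so all fail with probability at most 1 / (1
  + R p) \<le> 1 / 10. Rounding R up turns the 9 into 10 in the query bound.\<close>

lemma amplified_search:
  assumes k: "2 \<le> k" and find: "findable k \<epsilon> \<delta>" and \<delta>: "0 < \<delta>" "\<delta> \<le> 1" and \<epsilon>: "\<epsilon> \<le> 1"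
    and n: "1 \<le> n" "n \<le> 2 ^ T"
  obtains A :: "nat list randomized_algorithm" where
    "queries_inside n A" "nonadaptive A"
    "makes_at_most_queries A (10 / \<delta>\<^sup>2 * real (search_cost T k))"
    "\<And>f. far_from_free n k \<epsilon> f \<Longrightarrow>
       9 / 10 \<le> measure_pmf.prob A {t. monotone_subsequence n k f (run t f)}"
proof -
  define R where "R = nat \<lceil>9 / \<delta>\<^sup>2\<rceil>"
  define B where "B = sample {1..n} (search n T k)"
  define U where "U = unions (\<lambda>_. B) [0..<R]"
  define A where "A = map_pmf (\<lambda>u. query_all u (\<lambda>_. 0) (report k u)) U"
  have d2: "0 < \<delta>\<^sup>2" "\<delta>\<^sup>2 \<le> 1" using \<delta> by (auto intro: power_le_one)
  have R: "9 / \<delta>\<^sup>2 \<le> real R" "real R \<le> 10 / \<delta>\<^sup>2"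
  proof -
    show "9 / \<delta>\<^sup>2 \<le> real R" unfolding R_def by (rule real_nat_ceiling_ge)
    have "0 \<le> 9 / \<delta>\<^sup>2" by simp
    then have "real R \<le> 9 / \<delta>\<^sup>2 + 1" unfolding R_def by linarith
    also have "1 \<le> 1 / \<delta>\<^sup>2" using d2 by simp
    finally show "real R \<le> 10 / \<delta>\<^sup>2" by (simp add: add_divide_distrib[symmetric])
  qed
  have B: "set u \<subseteq> {1..n} \<and> length u \<le> search_cost T k" if u: "u \<in> set_pmf B" for u
  proof -
    have "set_pmf B = (\<Union>y\<in>{1..n}. set_pmf (search n T k y))"
      unfolding B_def using n by (intro set_sample) auto
    then obtain y where "y \<in> {1..n}" "u \<in> set_pmf (search n T k y)" using u by auto
    then show ?thesis by (rule search_inside)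
  qed
  have U: "set u \<subseteq> {1..n}" "length u \<le> R * search_cost T k" if "u \<in> set_pmf U" for u
    using set_unions_subset[of "[0..<R]" "\<lambda>_. B" "{1..n}" u, OF conjunct1[OF B]]
      length_unions[of "[0..<R]" "\<lambda>_. B" "search_cost T k" u, OF conjunct2[OF B]] that
    unfolding U_def by simp_all
  show thesis
  proof (rule that[of A])
    show "queries_inside n A"
      unfolding queries_inside_def A_def using U(1) by (simp add: queries_query_all)
    show "nonadaptive A"
      unfolding nonadaptive_def A_def by (simp add: queries_query_all)
    show "makes_at_most_queries A (10 / \<delta>\<^sup>2 * real (search_cost T k))"
      unfolding makes_at_most_queries_def
    proof (intro ballI allI)
      fix t f assume "t \<in> set_pmf A"
      then obtain u where "u \<in> set_pmf U" and t: "t = query_all u (\<lambda>_. 0) (report k u)"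
        unfolding A_def by auto
      then have "real (length u) \<le> real (R * search_cost T k)" using U(2) by (intro of_nat_mono)
      also have "\<dots> \<le> 10 / \<delta>\<^sup>2 * real (search_cost T k)"
        using R(2) unfolding of_nat_mult by (rule mult_right_mono) simp
      finally show "real (length (queries t f)) \<le> 10 / \<delta>\<^sup>2 * real (search_cost T k)"
        unfolding t queries_query_all .
    qed
    fix f assume far: "far_from_free n k \<epsilon> f"
    let ?P = "\<lambda>A. contains_ascending f k (A \<inter> {1..n})"
    define p where "p = measure_pmf.prob B {u. ?P (set u)}"
    have "hitting_at_least f k {1..n} (\<epsilon> * real (card {1..n}))"
      using far_from_free_hitting[OF far n(1) \<epsilon>] by simp
    then have p: "\<delta>\<^sup>2 \<le> p" unfolding p_def B_def
      using n \<delta> by (intro findable_sample[OF find]) auto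
    have "p \<le> 1" unfolding p_def by simp
    have "9 \<le> real R * \<delta>\<^sup>2" using R(1) d2(1) by (simp add: field_simps)
    also have "\<dots> \<le> real R * p" using p by (intro mult_left_mono) auto
    finally have Rp: "9 \<le> real R * p" .
    define \<pi> where "\<pi> = (\<Prod>t\<leftarrow>[0..<R]. 1 - p)"
    have "(\<Sum>t\<leftarrow>[0..<R]. p) = real R * p" by (simp add: sum_list_triv)
    then have "\<pi> * (1 + real R * p) \<le> 1" "0 \<le> \<pi>"
      using prod_one_minus_le[of "[0..<R]" "\<lambda>_. p"] p d2 \<open>p \<le> 1\<close> unfolding \<pi>_def by auto
    moreover have "\<pi> * 10 \<le> \<pi> * (1 + real R * p)" using Rp \<open>0 \<le> \<pi>\<close> by (intro mult_left_mono) auto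
    ultimately have "\<pi> \<le> 1 / 10" by simp
    moreover have "measure_pmf.prob U {w. \<not> ?P (set w)} \<le> \<pi>"
      using prob_fail_unions[OF mono_contains, of "\<lambda>_. B" "[0..<R]" f k "{1..n}"]
      unfolding U_def \<pi>_def p_def prob_not .
    ultimately have "9 / 10 \<le> measure_pmf.prob U {w. ?P (set w)}"
      unfolding prob_not by linarith
    also have "\<dots> \<le> measure_pmf.prob U {u. monotone_subsequence n k f (run (query_all u (\<lambda>_. 0) (report k u)) f)}"
    proof (rule measure_pmf.finite_measure_mono_AE)
      show "AE u in U. u \<in> {w. ?P (set w)} \<longrightarrow>
          u \<in> {u. monotone_subsequence n k f (run (query_all u (\<lambda>_. 0) (report k u)) f)}"
        unfolding AE_measure_pmf_iff
      proof (intro ballI impI)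
        fix u assume u: "u \<in> set_pmf U" "u \<in> {w. ?P (set w)}"
        have "set u \<inter> {1..n} = set u" by (rule Int_absorb2[OF U(1)[OF u(1)]])
        then have "contains_ascending f k (set u)" using u(2) by (simp only: mem_Collect_eq)
        from run_report[OF this U(1)[OF u(1)]]
        show "u \<in> {u. monotone_subsequence n k f (run (query_all u (\<lambda>_. 0) (report k u)) f)}"
          by (rule CollectI)
      qed
    qed simp
    finally show "9 / 10 \<le> measure_pmf.prob A {t. monotone_subsequence n k f (run t f)}"
      unfolding A_def by (simp add: vimage_def)
  qed
qed

theorem theorem1p1:
  fixes k :: nat
  assumes "k \<ge> 1"
  shows "\<exists>p :: real poly. \<forall>\<epsilon> :: real. \<epsilon> > 0 \<longrightarrow>
    (\<exists>A :: nat \<Rightarrow> nat list randomized_algorithm. \<forall>n\<ge>1.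
       queries_inside n (A n) \<and>
       nonadaptive (A n) \<and>
       makes_at_most_queries (A n) (log 2 (real n) ^ nat \<lfloor>log 2 (real k)\<rfloor> * poly p (1 / \<epsilon>)) \<and>
       (\<forall>f. far_from_free n k \<epsilon> f \<longrightarrow>
          measure_pmf.prob (A n) {t. monotone_subsequence n k f (run t f)} \<ge> 9 / 10))"
proof -
  have trivial: "queries_inside n (return_pmf (Output xs))" "nonadaptive (return_pmf (Output xs))"
    "0 \<le> q \<Longrightarrow> makes_at_most_queries (return_pmf (Output xs)) q" for n q and xs :: "nat list"
    unfolding queries_inside_def nonadaptive_def makes_at_most_queries_def by auto
  show ?thesis
  proof (cases "k = 1")
    \<comment> \<open>Every single position is a pattern of length 1, so a constant answer without
      queries suffices, with the zero polynomial as bound.\<close>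
    case True
    have "monotone_subsequence n k f [1]" if "1 \<le> n" for n f
      using that True unfolding monotone_subsequence_iff by simp
    then show ?thesis
      by (intro exI[of _ 0] allI impI exI[of _ "\<lambda>n. return_pmf (Output [1])"])
        (auto simp: trivial)
  next
    case False
    then have k: "2 \<le> k" using assms by simp
    define d where "d = floor_log k"
    have d: "nat \<lfloor>log 2 (real k)\<rfloor> = d" unfolding d_def floor_log_altdef using k by simp
    have "k \<in> {1..k}" using k by simp
    then obtain c e where c: "0 < c" "c \<le> 1"
      and find: "\<And>\<epsilon>. 0 < \<epsilon> \<Longrightarrow> \<epsilon> \<le> 1 \<Longrightarrow> findable k \<epsilon> (c * \<epsilon> ^ e)"
      using findable_polynomially[of k] by blast
    obtain C where C: "0 \<le> C" "\<And>T. real (search_cost T k) \<le> C * real (Suc T) ^ d"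
      using search_cost_bound[of k] unfolding d_def by blast
    \<comment> \<open>The factor 10 / c ^ 2 and the exponent 2 e come from 10 / \<delta> ^ 2 with
      \<delta> = c \<epsilon> ^ e, and 3 ^ d from Suc T \<le> 3 log n; none of them depends on
      \<epsilon> or n.\<close>
    define K where "K = 10 * C * 3 ^ d / c\<^sup>2"
    have K: "0 \<le> K" unfolding K_def using C c by simp
    let ?p = "monom K (2 * e)"
    have "\<exists>A :: nat list randomized_algorithm. queries_inside n A \<and> nonadaptive A \<and>
       makes_at_most_queries A (log 2 (real n) ^ d * poly ?p (1 / \<epsilon>)) \<and>
       (\<forall>f. far_from_free n k \<epsilon> f \<longrightarrow> measure_pmf.prob A {t. monotone_subsequence n k f (run t f)} \<ge> 9 / 10)"
      if \<epsilon>: "0 < \<epsilon>" and n: "1 \<le> n" for \<epsilon> n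
    proof -
      have logn: "0 \<le> log 2 (real n)" using n by simp
      have q: "0 \<le> log 2 (real n) ^ d * poly ?p (1 / \<epsilon>)"
        using K \<epsilon> logn by (simp add: poly_monom)
      show ?thesis
      proof (cases "\<epsilon> \<le> 1 \<and> 2 \<le> n")
        \<comment> \<open>For n = 1 the query bound is 0, as log 2 1 = 0 and d \<ge> 1. No function
          is far for n = 1 or for \<epsilon> > 1, so an algorithm without queries meets the
          requirement.\<close>
        case False
        have "\<not> far_from_free n k \<epsilon> f" for f
        proof (cases "\<epsilon> \<le> 1")
          case True
          then have "n = 1" using False n by simp
          show ?thesis
          proof
            assume "far_from_free n k \<epsilon> f"
            from far_from_free_hitting[OF this n True] have "contains_ascending f k ({1..n} - {})"
              using \<epsilon> n unfolding hitting_at_least_def by fastforce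
            then have "k \<le> card {1..n}" using contains_ascending_card by fastforce
            then show False using k \<open>n = 1\<close> by simp
          qed
        qed (use not_far_if_gt_one k in auto)
        then show ?thesis using trivial q by blast
      next
        case True
        define \<delta> where "\<delta> = c * \<epsilon> ^ e"
        define T where "T = Suc (floor_log n)"
        have "0 \<le> \<epsilon> ^ e" "\<epsilon> ^ e \<le> 1" using \<epsilon> True by (simp_all add: power_le_one)
        then have \<delta>: "0 < \<delta>" "\<delta> \<le> 1" unfolding \<delta>_def using c \<epsilon> mult_le_one[OF c(2)] by simp_all
        have T: "n \<le> 2 ^ T" unfolding T_def using floor_log_exp2_ge[of n] by simp
        have "floor_log n = nat \<lfloor>log 2 (real n)\<rfloor>" using n floor_log_altdef[of n] by simp
        then have "real (floor_log n) \<le> log 2 (real n)" using of_nat_floor[OF logn] by metis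
        \<comment> \<open>Suc T is \<open>floor_log n\<close> + 2, and the constant 2 is at most 2
          log n only because n \<ge> 2.\<close>
        moreover have "log 2 2 \<le> log 2 (real n)" using True by (subst log_le_cancel_iff) auto
        ultimately have "real (Suc T) \<le> 3 * log 2 (real n)" unfolding T_def by simp
        then have "real (Suc T) ^ d \<le> (3 * log 2 (real n)) ^ d" by (rule power_mono) simp
        then have "C * real (Suc T) ^ d \<le> C * (3 * log 2 (real n)) ^ d" using C(1) by (rule mult_left_mono)
        then have "real (search_cost T k) \<le> C * (3 * log 2 (real n)) ^ d" using C(2)[of T] by linarith
        then have "10 / \<delta>\<^sup>2 * real (search_cost T k) \<le> 10 / \<delta>\<^sup>2 * (C * (3 * log 2 (real n)) ^ d)"
          by (intro mult_left_mono) auto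
        also have "\<dots> = log 2 (real n) ^ d * poly ?p (1 / \<epsilon>)"
          unfolding \<delta>_def K_def poly_monom
          by (simp add: power_mult_distrib power_divide power_mult[symmetric] mult_ac)
        finally have cost: "10 / \<delta>\<^sup>2 * real (search_cost T k) \<le> log 2 (real n) ^ d * poly ?p (1 / \<epsilon>)" .
        obtain A :: "nat list randomized_algorithm" where A: "queries_inside n A" "nonadaptive A"
            "makes_at_most_queries A (10 / \<delta>\<^sup>2 * real (search_cost T k))"
            "\<And>f. far_from_free n k \<epsilon> f \<Longrightarrow>
              9 / 10 \<le> measure_pmf.prob A {t. monotone_subsequence n k f (run t f)}"
          by (rule amplified_search[OF k find[OF \<epsilon> conjunct1[OF True], folded \<delta>_def] \<delta> conjunct1[OF True] n T])
            (rule that)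
        have "makes_at_most_queries A (log 2 (real n) ^ d * poly ?p (1 / \<epsilon>))"
          using A(3) cost unfolding makes_at_most_queries_def by (meson order_trans)
        then show ?thesis using A(1,2,4) by blast
      qed
    qed
    then have "\<exists>A :: nat \<Rightarrow> nat list randomized_algorithm. \<forall>n\<ge>1. queries_inside n (A n) \<and> nonadaptive (A n) \<and>
       makes_at_most_queries (A n) (log 2 (real n) ^ d * poly ?p (1 / \<epsilon>)) \<and>
       (\<forall>f. far_from_free n k \<epsilon> f \<longrightarrow> measure_pmf.prob (A n) {t. monotone_subsequence n k f (run t f)} \<ge> 9 / 10)"
      if "0 < \<epsilon>" for \<epsilon>
      using that by (intro choice) blast
    then show ?thesis unfolding d by blast
  qed
qed

end
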